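(* Let $\mathcal D_n$ denote the maximal degree in the graph after $n$ steps. Then \[ \mathcal D_n\sim\frac{\alpha_2}{\alpha}\,\mu\,n^{\alpha}\quad\text{almost surely as } n\to\infty, \] where $\mu=\sup\{\zeta_j:j\ge-2\}$ is a finite and positive random variable.
   Context: Random graph model with parameters $0<p\le 1$, $q,r\in[0,1]$. Vertices, edges and triangles carry nonnegative integer weights. At time $0$ there is a single triangle on three vertices; the triangle has weight $1$ and each of its three edges has weight $1$ (all other pairs/triplets have weight $0$). At each step $n=1,2,\dots$ three vertices interact, chosen as follows, all the choices of rule being independent of the past. With probability $p$ a new vertex is added and it interacts with two distinct old vertices: with (conditional) probability $r$ these are the endpoints of an edge chosen with probability proportional to its weight, and with probability $1-r$ they are two distinct old vertices chosen uniformly at random. With probability $1-p$ three old vertices interact: with (conditional) probability $q$ a triangle is chosen with probability proportional to its weight, and with probability $1-q$ three distinct old vertices are chosen uniformly at random. After the three interacting vertices are selected, any missing edges among them are drawn, and the weight of the triangle they form and of each of its three edges is increased by $1$. The weight of a vertex is the sum of the weights of the triangles containing it; its degree is its number of neighbours. The three initial vertices are labelled $-2,-1,0$; later vertices are labelled $1,2,\dots$ in the order they are added. $W[n,j]$ is the weight of vertex $j$ after step $n$ if it exists by then, and $0$ otherwise. Constants: $\alpha_1=(1-p)q$, $\alpha_2=\frac{2pr}{3}$, $\alpha=\alpha_1+\alpha_2$. Known fact (from earlier work) defining $\zeta_j$: for each fixed $j\ge0$ (and, since the weights of the three initial vertices are interchangeable, also for $j=-2,-1$), $W[n,j]\sim\zeta_j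 n^{\alpha}$ almost surely as $n\to\infty$, where $\zeta_j$ is a positive random variable. *)

theory Defs
  imports "HOL-Probability.Probability" "HOL-Library.Landau_Symbols"
begin

text \<open>
  A state of the graph. The weight of an edge (a two-element set of vertices) or of a
  triangle (a three-element set of vertices) is its multiplicity in the respective multiset;
  the edges present in the graph are the pairs of positive weight. Vertices carry the
  labels \<open>-2, -1, 0, 1, \<dots>\<close>.
\<close>

record graph_state =
  vertices :: "int set"
  edges :: "int set multiset"
  triangles :: "int set multiset"

definition initial_state :: graph_state where
  "initial_state = \<lparr>vertices = {-2, -1, 0},
     edges = {#{-2, -1}, {-2, 0}, {-1, 0}#}, triangles = {#{-2, -1, 0}#}\<rparr>"

definition new_vertex :: "graph_state \<Rightarrow> int" where
  "new_vertex s = Max (vertices s) + 1"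

definition subsets_of_card :: "nat \<Rightarrow> int set \<Rightarrow> int set set" where
  "subsets_of_card k V = {A. A \<subseteq> V \<and> card A = k}"

text \<open>
  The random set of interacting vertices. Sampling from \<^const>\<open>pmf_of_multiset\<close> chooses an
  element with probability proportional to its multiplicity, that is, to its weight.
\<close>

definition interacting :: "real \<Rightarrow> real \<Rightarrow> real \<Rightarrow> graph_state \<Rightarrow> int set pmf" where
  "interacting p q r s =
     bind_pmf (bernoulli_pmf p) (\<lambda>add_vertex.
       if add_vertex then
         map_pmf (insert (new_vertex s))
           (bind_pmf (bernoulli_pmf r) (\<lambda>preferential.
              if preferential then pmf_of_multiset (edges s)
              else pmf_of_set (subsets_of_card 2 (vertices s))))
       else
         bind_pmf (bernoulli_pmf q) (\<lambda>preferential.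
           if preferential then pmf_of_multiset (triangles s)
           else pmf_of_set (subsets_of_card 3 (vertices s))))"

definition interact :: "int set \<Rightarrow> graph_state \<Rightarrow> graph_state" where
  "interact t s = \<lparr>vertices = vertices s \<union> t,
     edges = edges s + mset_set (subsets_of_card 2 t),
     triangles = triangles s + {#t#}\<rparr>"

definition step :: "real \<Rightarrow> real \<Rightarrow> real \<Rightarrow> graph_state \<Rightarrow> graph_state pmf" where
  "step p q r s = map_pmf (\<lambda>t. interact t s) (interacting p q r s)"

text \<open>
  \<open>G\<close> is a realisation of the model on the probability space \<open>M\<close>: a Markov chain started in
  the initial triangle whose transition probabilities are given by \<open>step\<close>. The Markov
  property is stated as a product rule for the probabilities of finite histories \<open>h\<close>.
\<close>

definition three_interaction_process ::
    "real \<Rightarrow> real \<Rightarrow> real \<Rightarrow> 'a measure \<Rightarrow> (nat \<Rightarrow> 'a \<Rightarrow> graph_state) \<Rightarrow> bool" where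
  "three_interaction_process p q r M G \<longleftrightarrow>
     prob_space M \<and>
     (\<forall>n. G n \<in> measurable M (count_space UNIV)) \<and>
     (AE \<omega> in M. G 0 \<omega> = initial_state) \<and>
     (\<forall>n h. measure M {\<omega> \<in> space M. \<forall>i\<le>Suc n. G i \<omega> = h i} =
            measure M {\<omega> \<in> space M. \<forall>i\<le>n. G i \<omega> = h i} * pmf (step p q r (h n)) (h (Suc n)))"

text \<open>The value is 0 for a label \<open>j\<close> that is not (yet) a vertex.\<close>

definition vertex_weight :: "graph_state \<Rightarrow> int \<Rightarrow> nat" where
  "vertex_weight s j = (\<Sum>t\<in>{t \<in> set_mset (triangles s). j \<in> t}. count (triangles s) t)"

definition vertex_degree :: "graph_state \<Rightarrow> int \<Rightarrow> nat" where
  "vertex_degree s v = card {u \<in> vertices s. u \<noteq> v \<and> {u, v} \<in># edges s}"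

definition max_degree :: "graph_state \<Rightarrow> nat" where
  "max_degree s = Max (vertex_degree s ` vertices s)"

definition alpha1 :: "real \<Rightarrow> real \<Rightarrow> real" where
  "alpha1 p q = (1 - p) * q"

definition alpha2 :: "real \<Rightarrow> real \<Rightarrow> real" where
  "alpha2 p r = 2 * p * r / 3"

definition alpha :: "real \<Rightarrow> real \<Rightarrow> real \<Rightarrow> real" where
  "alpha p q r = alpha1 p q + alpha2 p r"

end

theory Submission
  imports Defs "HOL-Real_Asymp.Real_Asymp"
begin

text \<open>
Every almost sure statement below comes from one principle, a form of Ville's inequality: if
\<open>y\<^sub>n \<ge> 0\<close> has conditional mean at most 1 given the past, then the products \<open>y\<^sub>0 \<cdots> y\<^sub>n\<close> exceed a
level \<open>x\<close> at some time with probability at most \<open>1 / x\<close>. In particular they stay bounded almost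
surely. Taking exponentials of increments for \<open>y\<^sub>n\<close> turns this into almost sure linear
inequalities between functionals of the graph, and no further limit theory is needed.

Write \<open>W\<close>, \<open>D\<close> for the weight and degree of a vertex \<open>j\<close> and \<open>V\<close> for the number of vertices.
In step \<open>n + 1\<close> the vertex \<open>j\<close> interacts through a weighted edge together with a new vertex with
probability \<open>\<alpha>\<^sub>2 W / (n + 1)\<close>, which raises both \<open>W\<close> and \<open>D\<close> by 1; through a weighted triangle
with probability \<open>\<alpha>\<^sub>1 W / (n + 1)\<close>, which raises \<open>W\<close> only, since all its edges exist already; and
through a uniform choice with probability \<open>\<beta> / V\<close>. As \<open>V\<close> grows linearly, the uniform choices
contribute only \<open>O(log n)\<close>.

For a single vertex: if \<open>\<alpha>\<^sub>2 e\<^sup>a + \<alpha>\<^sub>1 = \<alpha> e\<^sup>b\<close>, then the two weighted effects on the mean of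
\<open>exp (a D - b W)\<close> cancel, so \<open>a D \<le> b W + O(log n)\<close>. Since \<open>b / a \<rightarrow> \<alpha>\<^sub>2 / \<alpha>\<close> as \<open>a \<rightarrow> 0\<close> from either
side, \<open>D / n\<^sup>\<alpha> \<rightarrow> (\<alpha>\<^sub>2 / \<alpha>) \<zeta>\<^sub>j\<close> (lemma \<open>AE_degree_growth\<close>).

Uniformly over late vertices: apply the maximal inequality to the rising factorial
\<open>(W + b)(W + b + 1) \<cdots> (W + b + k - 1)\<close> divided by \<open>\<Prod> (1 + k \<alpha> / (m + 1))\<close>. A vertex of label \<open>j\<close>
does not exist before time \<open>j\<close>, so its \<open>k\<close>-th moment relative to \<open>n\<^bsup>k\<alpha>\<^esup>\<close> is of order
\<open>j\<^bsup>-k\<alpha>\<^esup>\<close>; for \<open>k \<alpha> \<ge> 3\<close> the Borel-Cantelli lemma gives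
\<open>sup\<^sub>n W / n\<^sup>\<alpha> \<rightarrow> 0\<close> as \<open>j \<rightarrow> \<infinity>\<close> (lemma \<open>AE_late_vertices_small\<close>).

Because the degree is at most twice the weight, late vertices compete neither for the maximal
degree nor for the supremum of the \<open>\<zeta>\<^sub>j\<close>. The supremum is therefore a maximum over finitely many
vertices, and the limit of the maximal degree is the maximum of the finitely many individual limits
(lemma \<open>max_degree_limit\<close>).

The argument requires \<open>\<alpha> > 0\<close>. If \<open>\<alpha> = 0\<close>, the assumed asymptotics would make the
weight of a vertex converge, whereas the weight of the vertex 0 tends to infinity (lemma
\<open>AE_weight_unbounded_if_alpha_0\<close>), so this case is contradictory.
\<close>

section \<open>A maximal inequality for Markov chains\<close>

text \<open>
The Markov property is the product rule for finite histories, as in the model. The state space may be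
uncountable, in which case a set of histories need not be measurable for the product of the discrete
sigma algebras; therefore only countable sets of histories are used.
\<close>

locale pmf_chain = prob_space M for M :: "'a measure" +
  fixes X :: "nat \<Rightarrow> 'a \<Rightarrow> 's" and K :: "'s \<Rightarrow> 's pmf" and s0 :: 's
  assumes measurable_X: "X n \<in> measurable M (count_space UNIV)"
    and X_0: "AE \<omega> in M. X 0 \<omega> = s0"
    and history_step: "measure M {\<omega> \<in> space M. \<forall>i\<le>Suc n. X i \<omega> = h i} =
      measure M {\<omega> \<in> space M. \<forall>i\<le>n. X i \<omega> = h i} * pmf (K (h n)) (h (Suc n))"
begin

definition history :: "nat \<Rightarrow> 'a \<Rightarrow> 's list" where
  "history n \<omega> = map (\<lambda>i. X i \<omega>) [0..<Suc n]"

primrec history_pmf :: "nat \<Rightarrow> 's list pmf" where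
  "history_pmf 0 = return_pmf [s0]"
| "history_pmf (Suc n) = bind_pmf (history_pmf n) (\<lambda>h. map_pmf (\<lambda>s. h @ [s]) (K (last h)))"

lemma history_eq_iff:
  "length l = Suc n \<Longrightarrow> history n \<omega> = l \<longleftrightarrow> (\<forall>i\<le>n. X i \<omega> = l ! i)"
  by (auto simp: history_def list_eq_iff_nth_eq nth_append less_Suc_eq_le simp del: upt_Suc)

lemma length_history [simp]: "length (history n \<omega>) = Suc n"
  by (simp add: history_def)

lemma history_nth: "i \<le> n \<Longrightarrow> history n \<omega> ! i = X i \<omega>"
  by (simp add: history_def del: upt_Suc)

lemma length_history_pmf: "h \<in> set_pmf (history_pmf n) \<Longrightarrow> length h = Suc n"
  by (induction n arbitrary: h) auto

lemma sets_history_eq [measurable]: "{\<omega> \<in> space M. history n \<omega> = l} \<in> sets M"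
proof (cases "length l = Suc n")
  case True
  have "{\<omega> \<in> space M. X i \<omega> = l ! i} \<in> sets M" for i
    using measurable_sets[OF measurable_X[of i], of "{l ! i}"]
    by (simp add: vimage_def Int_def conj_commute)
  then have "(\<Inter>i\<in>{..n}. {\<omega> \<in> space M. X i \<omega> = l ! i}) \<in> sets M"
    by (intro sets.finite_INT) simp_all
  moreover have "(\<Inter>i\<in>{..n}. {\<omega> \<in> space M. X i \<omega> = l ! i}) = {\<omega> \<in> space M. history n \<omega> = l}"
    unfolding history_eq_iff[OF True] by blast
  ultimately show ?thesis by simp
next
  case False
  then have "{\<omega> \<in> space M. history n \<omega> = l} = {}" by auto
  then show ?thesis by (simp only: sets.empty_sets)
qed

lemma history_pmf_Suc:
  assumes "length h = Suc n"
  shows "pmf (history_pmf (Suc n)) (h @ [s]) = pmf (history_pmf n) h * pmf (K (last h)) s"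
proof -
  have "pmf (map_pmf (\<lambda>s. h' @ [s]) (K (last h'))) (h @ [s]) = indicator {h} h' * pmf (K (last h)) s" for h'
  proof (cases "h' = h")
    case True
    then show ?thesis
      using pmf_map_inj'[of "\<lambda>s. h @ [s]" "K (last h)" s] by (simp add: inj_def)
  next
    case False
    then show ?thesis by (auto simp: pmf_eq_0_set_pmf)
  qed
  then show ?thesis
    by (simp add: pmf_bind measure_pmf_single)
qed

lemma prob_history_eq:
  "length l = Suc n \<Longrightarrow> prob {\<omega> \<in> space M. history n \<omega> = l} = pmf (history_pmf n) l"
proof (induction n arbitrary: l)
  case 0
  then obtain s where l: "l = [s]" by (cases l) auto
  have "{\<omega> \<in> space M. history 0 \<omega> = l} = {\<omega> \<in> space M. X 0 \<omega> = s}"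
    by (auto simp: l history_def)
  moreover have m: "{\<omega> \<in> space M. X 0 \<omega> = s} \<in> sets M"
    using sets_history_eq[of 0 "[s]"] by (simp add: history_def)
  have "prob {\<omega> \<in> space M. X 0 \<omega> = s} = (if s = s0 then 1 else 0)"
  proof (cases "s = s0")
    case True
    then show ?thesis using X_0 prob_Collect_eq_1[OF m] by simp
  next
    case False
    have "AE \<omega> in M. X 0 \<omega> \<noteq> s" using X_0 by eventually_elim (use False in auto)
    then show ?thesis using False prob_Collect_eq_0[OF m] by simp
  qed
  ultimately show ?case by (simp add: l pmf_return)
next
  case (Suc n)
  then obtain h s where l: "l = h @ [s]" and h: "length h = Suc n"
    by (metis length_Suc_conv_rev)
  have "h \<noteq> []" using h by auto
  then have "last h = l ! n" "s = l ! Suc n" using h by (simp_all add: l nth_append last_conv_nth)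
  moreover have "{\<omega> \<in> space M. history n \<omega> = h} = {\<omega> \<in> space M. \<forall>i\<le>n. X i \<omega> = l ! i}"
    using h by (simp add: history_eq_iff l nth_append)
  ultimately have "prob {\<omega> \<in> space M. history (Suc n) \<omega> = l}
      = prob {\<omega> \<in> space M. history n \<omega> = h} * pmf (K (last h)) s"
    using history_step[of n "\<lambda>i. l ! i"] Suc.prems by (simp only: history_eq_iff)
  then show ?case
    using Suc.IH[OF h] history_pmf_Suc[OF h, of s] l by simp
qed

lemma
  assumes "countable B"
  shows sets_history_in: "{\<omega> \<in> space M. history n \<omega> \<in> B} \<in> sets M"
    and emeasure_history_in: "(\<And>l. l \<in> B \<Longrightarrow> length l = Suc n) \<Longrightarrow>
      emeasure M {\<omega> \<in> space M. history n \<omega> \<in> B} = emeasure (history_pmf n) B"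
proof -
  have *: "{\<omega> \<in> space M. history n \<omega> \<in> B} = (\<Union>l\<in>B. {\<omega> \<in> space M. history n \<omega> = l})"
    by auto
  show "{\<omega> \<in> space M. history n \<omega> \<in> B} \<in> sets M"
    unfolding * using assms by (intro sets.countable_UN') auto
  assume len: "\<And>l. l \<in> B \<Longrightarrow> length l = Suc n"
  have "emeasure M {\<omega> \<in> space M. history n \<omega> \<in> B}
      = (\<integral>\<^sup>+l. emeasure M {\<omega> \<in> space M. history n \<omega> = l} \<partial>count_space B)"
    unfolding * using assms
    by (intro emeasure_UN_countable) (auto simp: disjoint_family_on_def)
  also have "\<dots> = (\<integral>\<^sup>+l. pmf (history_pmf n) l \<partial>count_space B)"
    using len by (intro nn_integral_cong) (simp add: emeasure_eq_measure prob_history_eq)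
  also have "\<dots> = emeasure (history_pmf n) B" by (rule nn_integral_pmf)
  finally show "emeasure M {\<omega> \<in> space M. history n \<omega> \<in> B} = emeasure (history_pmf n) B" .
qed

text \<open>
The probabilities of the histories in the countable support of their law already sum to 1.
\<close>

lemma AE_history_in_support: "AE \<omega> in M. \<forall>n. history n \<omega> \<in> set_pmf (history_pmf n)"
  unfolding AE_all_countable
proof
  fix n
  have "emeasure M {\<omega> \<in> space M. history n \<omega> \<in> set_pmf (history_pmf n)} = 1"
    by (subst emeasure_history_in) (auto simp: length_history_pmf emeasure_pmf)
  then show "AE \<omega> in M. history n \<omega> \<in> set_pmf (history_pmf n)"
    by (subst prob_Collect_eq_1[symmetric]) (auto simp: sets_history_in emeasure_eq_measure)
qed

lemma AE_transitions:
  "AE \<omega> in M. X 0 \<omega> = s0 \<and> (\<forall>n. X (Suc n) \<omega> \<in> set_pmf (K (X n \<omega>)))"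
  using AE_history_in_support
proof eventually_elim
  case (elim \<omega>)
  have "X (Suc n) \<omega> \<in> set_pmf (K (X n \<omega>))" for n
  proof -
    have "history (Suc n) \<omega> = history n \<omega> @ [X (Suc n) \<omega>]" "last (history n \<omega>) = X n \<omega>"
      by (simp_all add: history_def)
    then show ?thesis using elim[rule_format, of "Suc n"] by auto
  qed
  moreover have "X 0 \<omega> = s0"
    using elim[rule_format, of 0] by (auto simp: history_def)
  ultimately show ?case by blast
qed

text \<open>
The product of the factors \<open>y\<close> along a path, frozen from the first time that it reaches \<open>x\<close>.
Once at least \<open>x\<close> it stays there, so reaching \<open>x\<close> before time \<open>n\<close> can be read off at time \<open>n\<close>.
\<close>

primrec stopped :: "real \<Rightarrow> (nat \<Rightarrow> 's \<Rightarrow> 's \<Rightarrow> real) \<Rightarrow> (nat \<Rightarrow> 's) \<Rightarrow> nat \<Rightarrow> real" where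
  "stopped x y f 0 = 1"
| "stopped x y f (Suc n) =
     (if x \<le> stopped x y f n then stopped x y f n else stopped x y f n * y n (f n) (f (Suc n)))"

lemma stopped_cong: "(\<And>i. i \<le> n \<Longrightarrow> f i = g i) \<Longrightarrow> stopped x y f n = stopped x y g n"
  by (induction n) auto

lemma stopped_nonneg: "(\<And>n s s'. 0 \<le> y n s s') \<Longrightarrow> 0 \<le> stopped x y f n"
  by (induction n) auto

lemma stopped_mono: "x \<le> stopped x y f m \<Longrightarrow> m \<le> n \<Longrightarrow> x \<le> stopped x y f n"
  by (induction n) (auto simp: le_Suc_eq)

lemma stopped_eq: "x \<le> stopped x y f n \<or> stopped x y f n = (\<Prod>m<n. y m (f m) (f (Suc m)))"
  by (induction n) auto

text \<open>
The stopped product has mean at most 1 at each time, so by Markov's inequality it is at least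
\<open>x\<close> with probability at most \<open>1 / x\<close>; these events increase to the event that the product ever
reaches \<open>x\<close>. The latter event is covered by a measurable set \<open>A\<close> up to a null set, because it need
not be measurable itself. The predicate \<open>I\<close> is an invariant of the chain, so that the condition on
the conditional means only concerns states that can occur.
\<close>

lemma maximal_inequality:
  assumes y: "\<And>n s s'. 0 \<le> y n s s'"
    and I0: "I 0 s0" and IS: "\<And>n s s'. I n s \<Longrightarrow> s' \<in> set_pmf (K s) \<Longrightarrow> I (Suc n) s'"
    and le1: "\<And>n s. I n s \<Longrightarrow> (\<integral>\<^sup>+s'. ennreal (y n s s') \<partial>K s) \<le> 1"
    and x: "0 < x"
  obtains A where "A \<in> sets M" "emeasure M A \<le> ennreal (1 / x)"
    "AE \<omega> in M. (\<exists>n. x \<le> (\<Prod>m<n. y m (X m \<omega>) (X (Suc m) \<omega>))) \<longrightarrow> \<omega> \<in> A"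
proof -
  define B where "B n = {l \<in> set_pmf (history_pmf n). x \<le> stopped x y (\<lambda>i. l ! i) n}" for n
  define \<Omega> where "\<Omega> = {\<omega> \<in> space M. \<forall>n. history n \<omega> \<in> set_pmf (history_pmf n)}"
  define A where "A n = {\<omega> \<in> \<Omega>. x \<le> stopped x y (\<lambda>i. X i \<omega>) n}" for n
  have \<Omega>: "\<Omega> \<in> sets M"
    unfolding \<Omega>_def using sets_history_in[OF countable_set_pmf]
    by (intro sets.sets_Collect_countable_All) auto
  have stopped_history: "stopped x y (\<lambda>i. history n \<omega> ! i) n = stopped x y (\<lambda>i. X i \<omega>) n" for n \<omega>
    by (rule stopped_cong) (simp add: history_nth)
  have A_eq: "A n = {\<omega> \<in> space M. history n \<omega> \<in> B n} \<inter> \<Omega>" for n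
    by (auto simp: A_def B_def \<Omega>_def stopped_history)
  have cB: "countable (B n)" for n
    unfolding B_def by (rule countable_subset[OF _ countable_set_pmf[of "history_pmf n"]]) auto
  have A: "A n \<in> sets M" for n
    unfolding A_eq using \<Omega> sets_history_in[OF cB] by auto
  have I: "I n (last h)" if "h \<in> set_pmf (history_pmf n)" for n h
    using that
  proof (induction n arbitrary: h)
    case (Suc n)
    then obtain h' s where h': "h' \<in> set_pmf (history_pmf n)" "s \<in> set_pmf (K (last h'))" "h = h' @ [s]"
      by auto
    show ?case using IS[OF Suc.IH[OF h'(1)] h'(2)] h'(3) by simp
  qed (simp add: I0)
  have E: "(\<integral>\<^sup>+h. ennreal (stopped x y (\<lambda>i. h ! i) n) \<partial>history_pmf n) \<le> 1" for n
  proof (induction n)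
    case (Suc n)
    have "(\<integral>\<^sup>+s. ennreal (stopped x y (\<lambda>i. (h @ [s]) ! i) (Suc n)) \<partial>K (last h))
        \<le> ennreal (stopped x y (\<lambda>i. h ! i) n)" (is "?L \<le> _") if h: "h \<in> set_pmf (history_pmf n)" for h
    proof -
      have len: "length h = Suc n" using h by (rule length_history_pmf)
      then have eq: "stopped x y (\<lambda>i. (h @ [s]) ! i) n = stopped x y (\<lambda>i. h ! i) n" for s
        by (intro stopped_cong) (simp add: nth_append)
      have "h \<noteq> []" using len by auto
      then have last: "(h @ [s]) ! n = last h" "(h @ [s]) ! Suc n = s" for s
        using len by (simp_all add: nth_append last_conv_nth)
      show ?thesis
      proof (cases "x \<le> stopped x y (\<lambda>i. h ! i) n")
        case True
        then show ?thesis by (simp add: eq measure_pmf.emeasure_space_1)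
      next
        case False
        then have "?L = (\<integral>\<^sup>+s. ennreal (stopped x y (\<lambda>i. h ! i) n) * ennreal (y n (last h) s) \<partial>K (last h))"
          by (intro nn_integral_cong) (simp add: eq last ennreal_mult stopped_nonneg y)
        also have "\<dots> = ennreal (stopped x y (\<lambda>i. h ! i) n) * (\<integral>\<^sup>+s. ennreal (y n (last h) s) \<partial>K (last h))"
          by (rule nn_integral_cmult) simp
        also have "\<dots> \<le> ennreal (stopped x y (\<lambda>i. h ! i) n) * 1"
          by (intro mult_left_mono le1 I h) simp
        finally show ?thesis by simp
      qed
    qed
    then have "(\<integral>\<^sup>+h. ennreal (stopped x y (\<lambda>i. h ! i) (Suc n)) \<partial>history_pmf (Suc n))
        \<le> (\<integral>\<^sup>+h. ennreal (stopped x y (\<lambda>i. h ! i) n) \<partial>history_pmf n)"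
      unfolding history_pmf.simps nn_integral_bind_pmf nn_integral_map_pmf
      by (intro nn_integral_mono_AE) (simp add: AE_measure_pmf_iff del: stopped.simps)
    then show ?case using Suc.IH by (rule order_trans)
  qed simp
  have B: "emeasure (history_pmf n) (B n) \<le> ennreal (1 / x)" for n
  proof -
    have "emeasure (history_pmf n) (B n) \<le>
        emeasure (history_pmf n) {l \<in> UNIV. 1 \<le> ennreal (1 / x) * ennreal (stopped x y (\<lambda>i. l ! i) n)}"
      using x by (intro emeasure_mono)
        (auto simp: B_def ennreal_mult[symmetric] stopped_nonneg y field_simps)
    also have "\<dots> \<le> ennreal (1 / x) *
        (\<integral>\<^sup>+l. ennreal (stopped x y (\<lambda>i. l ! i) n) * indicator UNIV l \<partial>history_pmf n)"
      by (rule nn_integral_Markov_inequality) auto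
    also have "\<dots> \<le> ennreal (1 / x) * 1"
      using E[of n] by (intro mult_left_mono) auto
    finally show ?thesis by simp
  qed
  have "emeasure M (A n) \<le> ennreal (1 / x)" for n
  proof -
    have "emeasure M (A n) \<le> emeasure M {\<omega> \<in> space M. history n \<omega> \<in> B n}"
      unfolding A_eq by (intro emeasure_mono sets_history_in cB) auto
    also have "\<dots> = emeasure (history_pmf n) (B n)"
      by (intro emeasure_history_in cB) (auto simp: B_def length_history_pmf)
    finally show ?thesis using B[of n] by simp
  qed
  moreover have "incseq A"
    by (auto simp: incseq_def A_def intro: stopped_mono)
  ultimately have "emeasure M (\<Union>n. A n) \<le> ennreal (1 / x)"
    using A by (subst SUP_emeasure_incseq[symmetric]) (auto intro!: SUP_least)
  moreover have "AE \<omega> in M. (\<exists>n. x \<le> (\<Prod>m<n. y m (X m \<omega>) (X (Suc m) \<omega>))) \<longrightarrow> \<omega> \<in> (\<Union>n. A n)"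
    using AE_history_in_support AE_space
  proof eventually_elim
    case (elim \<omega>)
    then have "\<omega> \<in> \<Omega>" by (simp add: \<Omega>_def)
    then show ?case using stopped_eq[of x y "\<lambda>i. X i \<omega>"] by (simp add: A_def) metis
  qed
  ultimately show thesis using that[of "\<Union>n. A n"] A by blast
qed

text \<open>
The maximal inequality for a sequence of products, combined with the Borel-Cantelli lemma.
\<close>

lemma AE_eventually_below:
  assumes y: "\<And>i n s s'. 0 \<le> y i n s s'"
    and I0: "I 0 s0" and IS: "\<And>n s s'. I n s \<Longrightarrow> s' \<in> set_pmf (K s) \<Longrightarrow> I (Suc n) s'"
    and le1: "\<And>i n s. I n s \<Longrightarrow> (\<integral>\<^sup>+s'. ennreal (y i n s s') \<partial>K s) \<le> 1"
    and x: "\<And>i. 0 < x i" "summable (\<lambda>i. 1 / x i)"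
  shows "AE \<omega> in M. \<forall>\<^sub>F i in sequentially. \<forall>n. (\<Prod>m<n. y i m (X m \<omega>) (X (Suc m) \<omega>)) < x i"
proof -
  define P where "P i A \<longleftrightarrow> A \<in> sets M \<and> emeasure M A \<le> ennreal (1 / x i) \<and>
    (AE \<omega> in M. (\<exists>n. x i \<le> (\<Prod>m<n. y i m (X m \<omega>) (X (Suc m) \<omega>))) \<longrightarrow> \<omega> \<in> A)" for i A
  have "\<exists>A. P i A" for i
    unfolding P_def by (rule maximal_inequality[of "y i" I "x i", OF y I0 IS le1 x(1)]) blast+
  then obtain A where P: "\<And>i. P i (A i)" using choice[of P] by blast
  then have A: "\<And>i. A i \<in> sets M" "\<And>i. emeasure M (A i) \<le> ennreal (1 / x i)"
    "\<And>i. AE \<omega> in M. (\<exists>n. x i \<le> (\<Prod>m<n. y i m (X m \<omega>) (X (Suc m) \<omega>))) \<longrightarrow> \<omega> \<in> A i"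
    unfolding P_def by blast+
  have "norm (prob (A i)) \<le> 1 / x i" for i
    using A(2)[of i] x(1)[of i] by (simp add: emeasure_eq_measure)
  then have "summable (\<lambda>i. prob (A i))"
    by (rule summable_comparison_test'[OF x(2)])
  then have "AE \<omega> in M. \<forall>\<^sub>F i in sequentially. \<omega> \<in> space M - A i"
    using A(1) by (intro borel_cantelli_AE1) (auto simp: emeasure_eq_measure)
  moreover have "AE \<omega> in M. \<forall>i. (\<exists>n. x i \<le> (\<Prod>m<n. y i m (X m \<omega>) (X (Suc m) \<omega>))) \<longrightarrow> \<omega> \<in> A i"
    using A(3) by (simp add: AE_all_countable)
  ultimately show ?thesis
  proof eventually_elim
    case (elim \<omega>)
    note below = elim(2)
    from elim(1) show ?case
    proof eventually_elim
      case (elim i)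
      then show ?case using below by (meson DiffD2 not_le)
    qed
  qed
qed

text \<open>
Taking the same product for each index and the levels \<open>2 ^ i\<close> shows that it stays below some level.
\<close>

lemma AE_bounded:
  assumes y: "\<And>n s s'. 0 \<le> y n s s'"
    and I0: "I 0 s0" and IS: "\<And>n s s'. I n s \<Longrightarrow> s' \<in> set_pmf (K s) \<Longrightarrow> I (Suc n) s'"
    and le1: "\<And>n s. I n s \<Longrightarrow> (\<integral>\<^sup>+s'. ennreal (y n s s') \<partial>K s) \<le> 1"
  shows "AE \<omega> in M. \<exists>C. \<forall>n. (\<Prod>m<n. y m (X m \<omega>) (X (Suc m) \<omega>)) \<le> C"
proof -
  have "summable (\<lambda>i. 1 / 2 ^ i :: real)"
    using summable_geometric[of "1/2::real"] by (simp add: power_one_over)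
  then have "AE \<omega> in M. \<forall>\<^sub>F i in sequentially. \<forall>n. (\<Prod>m<n. y m (X m \<omega>) (X (Suc m) \<omega>)) < 2 ^ i"
    using assms by (intro AE_eventually_below[where I = I]) auto
  then show ?thesis
  proof eventually_elim
    case (elim \<omega>)
    then obtain i where "\<forall>n. (\<Prod>m<n. y m (X m \<omega>) (X (Suc m) \<omega>)) < 2 ^ i"
      using eventually_happens[OF elim] by auto
    then show ?case by (meson less_imp_le)
  qed
qed

end

section \<open>One interaction\<close>

lemma vertex_weight_eq_size: "vertex_weight s j = size (filter_mset (\<lambda>t. j \<in> t) (triangles s))"
  unfolding vertex_weight_def size_multiset_overloaded_eq
  by (intro sum.cong) auto

lemma vertex_weight_interact:
  "vertex_weight (interact t s) j = vertex_weight s j + of_bool (j \<in> t)"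
  by (simp add: vertex_weight_eq_size interact_def)

lemma vertices_interact [simp]: "vertices (interact t s) = vertices s \<union> t"
  and edges_interact [simp]: "edges (interact t s) = edges s + mset_set (subsets_of_card 2 t)"
  and triangles_interact [simp]: "triangles (interact t s) = triangles s + {#t#}"
  by (simp_all add: interact_def)

lemma finite_subsets_of_card [simp]: "finite V \<Longrightarrow> finite (subsets_of_card k V)"
  by (simp add: subsets_of_card_def)

lemma card_subsets_of_card: "finite V \<Longrightarrow> card (subsets_of_card k V) = card V choose k"
  by (simp add: subsets_of_card_def n_subsets)

text \<open>
Removing \<open>j\<close> is a bijection onto the subsets of \<open>V - {j}\<close> with \<open>k - 1\<close> elements.
\<close>

lemma card_subsets_of_card_containing:
  assumes "finite V" "j \<in> V" "0 < k"
  shows "card {A \<in> subsets_of_card k V. j \<in> A} = (card V - 1) choose (k - 1)"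
proof -
  have "bij_betw (insert j) (subsets_of_card (k - 1) (V - {j})) {A \<in> subsets_of_card k V. j \<in> A}"
  proof (rule bij_betw_byWitness[where f' = "\<lambda>A. A - {j}"])
    have "finite A" if "A \<subseteq> V" for A using that assms(1) by (rule finite_subset)
    then show "insert j ` subsets_of_card (k - 1) (V - {j}) \<subseteq> {A \<in> subsets_of_card k V. j \<in> A}"
      using assms by (auto simp: subsets_of_card_def card_insert_if subset_Diff_insert)
    show "(\<lambda>A. A - {j}) ` {A \<in> subsets_of_card k V. j \<in> A} \<subseteq> subsets_of_card (k - 1) (V - {j})"
      by (auto simp: subsets_of_card_def)
  qed (auto simp: subsets_of_card_def)
  then show ?thesis
    using bij_betw_same_card card_subsets_of_card[of "V - {j}"] assms by fastforce
qed

definition neighbours :: "graph_state \<Rightarrow> int \<Rightarrow> int set" where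
  "neighbours s j = {u \<in> vertices s. u \<noteq> j \<and> {u, j} \<in># edges s}"

lemma vertex_degree_eq_card: "vertex_degree s j = card (neighbours s j)"
  by (simp add: vertex_degree_def neighbours_def)

text \<open>
The invariants of the states after \<open>n\<close> steps. Each interaction adds one triangle and its three edges,
and two of these edges contain a given vertex of the triangle; hence the total weights and the relation
between the incident edge weight and the vertex weight. The bound on the largest label says that a
vertex of label \<open>j > 0\<close> is absent before time \<open>j\<close>.
\<close>

definition valid_state :: "nat \<Rightarrow> graph_state \<Rightarrow> bool" where
  "valid_state n s \<longleftrightarrow>
     (\<exists>v. 0 \<le> v \<and> v \<le> int n \<and> vertices s = {-2..v}) \<and>
     size (triangles s) = n + 1 \<and> size (edges s) = 3 * (n + 1) \<and>
     (\<forall>t\<in>#triangles s. t \<subseteq> vertices s \<and> card t = 3 \<and> (\<forall>u\<in>t. \<forall>v\<in>t. u \<noteq> v \<longrightarrow> {u, v} \<in># edges s)) \<and>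
     (\<forall>e\<in>#edges s. e \<subseteq> vertices s \<and> card e = 2) \<and>
     (\<forall>j. size (filter_mset (\<lambda>e. j \<in> e) (edges s)) = 2 * vertex_weight s j) \<and>
     (\<forall>j\<in>vertices s. 1 \<le> vertex_weight s j)"

context
  fixes n s
  assumes valid: "valid_state n s"
begin

lemma finite_vertices: "finite (vertices s)"
  using valid by (auto simp: valid_state_def)

lemma card_vertices: "3 \<le> card (vertices s)" "card (vertices s) \<le> n + 3"
  using valid by (auto simp: valid_state_def)

lemma initial_vertices: "j \<in> {-2, -1, 0} \<Longrightarrow> j \<in> vertices s"
  using valid by (auto simp: valid_state_def)

lemma vertex_label_bounds: "j \<in> vertices s \<Longrightarrow> -2 \<le> j \<and> j \<le> int n"
  using valid by (auto simp: valid_state_def)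

lemma new_vertex_properties:
  "vertices s = {-2..new_vertex s - 1}" "0 < new_vertex s" "new_vertex s \<le> int n + 1"
proof -
  obtain v where v: "0 \<le> v" "v \<le> int n" "vertices s = {-2..v}"
    using valid by (auto simp: valid_state_def)
  moreover from this have "Max (vertices s) = v" by (intro Max_eqI) auto
  ultimately have "new_vertex s = v + 1" by (simp add: new_vertex_def)
  with v show "vertices s = {-2..new_vertex s - 1}" "0 < new_vertex s" "new_vertex s \<le> int n + 1"
    by auto
qed

lemma new_vertex_fresh: "new_vertex s \<notin> vertices s"
  by (subst new_vertex_properties(1)) auto

lemma sizes: "size (triangles s) = n + 1" "size (edges s) = 3 * (n + 1)"
  using valid by (auto simp: valid_state_def)

lemma triangleD:
  assumes "t \<in># triangles s"
  shows "t \<subseteq> vertices s" "card t = 3" "u \<in> t \<Longrightarrow> v \<in> t \<Longrightarrow> u \<noteq> v \<Longrightarrow> {u, v} \<in># edges s"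
  using valid assms by (auto simp: valid_state_def)

lemma edgeD:
  assumes "e \<in># edges s"
  shows "e \<subseteq> vertices s" "card e = 2"
  using valid assms by (auto simp: valid_state_def)

lemma size_incident_edges: "size (filter_mset (\<lambda>e. j \<in> e) (edges s)) = 2 * vertex_weight s j"
  using valid by (auto simp: valid_state_def)

lemma vertex_weight_ge_1: "j \<in> vertices s \<Longrightarrow> 1 \<le> vertex_weight s j"
  using valid by (auto simp: valid_state_def)

lemma vertex_weight_unborn: "j \<notin> vertices s \<Longrightarrow> vertex_weight s j = 0"
  using triangleD(1) by (auto simp: vertex_weight_eq_size filter_mset_eq_conv)

lemma triangles_nonempty: "triangles s \<noteq> {#}" and edges_nonempty: "edges s \<noteq> {#}"
  using sizes by auto

lemma finite_neighbours: "finite (neighbours s j)"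
  using finite_vertices by (simp add: neighbours_def)

text \<open>
The edges at \<open>j\<close> have total weight \<open>2 W\<close>, and each neighbour accounts for at least one of them.
\<close>

lemma vertex_degree_le_weight: "vertex_degree s j \<le> 2 * vertex_weight s j"
proof -
  have "card (neighbours s j) = card ((\<lambda>u. {u, j}) ` neighbours s j)"
    by (intro card_image[symmetric] inj_onI) (auto simp: neighbours_def doubleton_eq_iff)
  also have "\<dots> \<le> card (set_mset (filter_mset (\<lambda>e. j \<in> e) (edges s)))"
    by (intro card_mono) (auto simp: neighbours_def)
  also have "\<dots> \<le> size (filter_mset (\<lambda>e. j \<in> e) (edges s))"
    unfolding size_multiset_overloaded_eq card_eq_sum by (intro sum_mono) auto
  finally show ?thesis
    by (simp add: vertex_degree_eq_card size_incident_edges)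
qed

lemma interacting_vertices:
  assumes "t \<in> set_pmf (interacting p q r s)"
  shows "t \<subseteq> insert (new_vertex s) (vertices s)" "card t = 3"
proof -
  have ne: "subsets_of_card k (vertices s) \<noteq> {}" if "k \<le> 3" for k
  proof
    assume "subsets_of_card k (vertices s) = {}"
    then have "card (vertices s) choose k = 0"
      using card_subsets_of_card[OF finite_vertices, of k] by simp
    then show False using card_vertices(1) that by simp
  qed
  have supports: "set_pmf (pmf_of_multiset (edges s)) = set_mset (edges s)"
    "set_pmf (pmf_of_multiset (triangles s)) = set_mset (triangles s)"
    "set_pmf (pmf_of_set (subsets_of_card 2 (vertices s))) = subsets_of_card 2 (vertices s)"
    "set_pmf (pmf_of_set (subsets_of_card 3 (vertices s))) = subsets_of_card 3 (vertices s)"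
    using triangles_nonempty edges_nonempty ne finite_vertices by simp_all
  have "t \<in> insert (new_vertex s) ` set_mset (edges s) \<union> insert (new_vertex s) ` subsets_of_card 2 (vertices s)
      \<union> set_mset (triangles s) \<union> subsets_of_card 3 (vertices s)"
    using assms by (auto simp: interacting_def supports split: if_splits)
  then consider e where "t = insert (new_vertex s) e" "e \<subseteq> vertices s" "card e = 2"
    | "t \<subseteq> vertices s" "card t = 3"
    using edgeD triangleD(1,2) by (auto simp: subsets_of_card_def)
  then have "t \<subseteq> insert (new_vertex s) (vertices s) \<and> card t = 3"
  proof cases
    case (1 e)
    moreover have "finite e" using 1(2) finite_vertices by (rule finite_subset)
    moreover have "new_vertex s \<notin> e" using 1(2) new_vertex_fresh by auto
    ultimately show ?thesis by auto
  qed auto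
  then show "t \<subseteq> insert (new_vertex s) (vertices s)" "card t = 3" by auto
qed

lemma finite_interacting: "finite (set_pmf (interacting p q r s))"
proof (rule finite_subset)
  show "set_pmf (interacting p q r s) \<subseteq> Pow (insert (new_vertex s) (vertices s))"
    using interacting_vertices(1) by blast
qed (use finite_vertices in simp)

lemma neighbours_interact:
  assumes "card t = 3" 
  shows "neighbours (interact t s) j = neighbours s j \<union> (if j \<in> t then t - {j} else {})"
proof -
  have "finite t" using assms card.infinite by fastforce
  then have "{u, j} \<in># edges (interact t s) \<longleftrightarrow> {u, j} \<in># edges s \<or> u \<in> t \<and> j \<in> t" if "u \<noteq> j" for u
    using that by (auto simp: subsets_of_card_def)
  moreover have "u \<in> vertices s" if "{u, j} \<in># edges s" for u
    using edgeD(1)[OF that] by simp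
  ultimately show ?thesis by (auto simp: neighbours_def)
qed

lemma vertex_degree_interact:
  assumes "card t = 3"
  shows "vertex_degree s j \<le> vertex_degree (interact t s) j"
    "vertex_degree (interact t s) j \<le> vertex_degree s j + 2 * of_bool (j \<in> t)"
proof -
  have "finite t" using assms card.infinite by fastforce
  then show "vertex_degree s j \<le> vertex_degree (interact t s) j"
    unfolding vertex_degree_eq_card neighbours_interact[OF assms]
    using finite_neighbours by (intro card_mono) auto
  show "vertex_degree (interact t s) j \<le> vertex_degree s j + 2 * of_bool (j \<in> t)"
    unfolding vertex_degree_eq_card neighbours_interact[OF assms]
    using card_Un_le[of "neighbours s j" "t - {j}"] assms by auto
qed

text \<open>
For a weighted edge containing \<open>j\<close> the only new neighbour of \<open>j\<close> is the new vertex: the other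
endpoint of the edge is a neighbour already.
\<close>

lemma vertex_degree_interact_edge:
  assumes "e \<in># edges s" and j: "j \<in> vertices s"
  shows "vertex_degree (interact (insert (new_vertex s) e) s) j = vertex_degree s j + of_bool (j \<in> e)"
proof -
  have e: "e \<subseteq> vertices s" "card e = 2" using edgeD[OF assms(1)] .
  then have fresh: "new_vertex s \<notin> e" using new_vertex_fresh by auto
  have "finite e" using e(1) finite_vertices by (rule finite_subset)
  then have c: "card (insert (new_vertex s) e) = 3" using fresh e by simp
  have "j \<noteq> new_vertex s" using j new_vertex_fresh by auto
  moreover have "e - {j} \<subseteq> neighbours s j" if "j \<in> e"
  proof
    fix u assume "u \<in> e - {j}"
    then have "{u, j} = e" using e(2) that by (auto simp: card_2_iff)
    then show "u \<in> neighbours s j"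
      using assms(1) \<open>u \<in> e - {j}\<close> e(1) by (auto simp: neighbours_def)
  qed
  ultimately have "neighbours (interact (insert (new_vertex s) e) s) j =
      (if j \<in> e then insert (new_vertex s) (neighbours s j) else neighbours s j)"
    unfolding neighbours_interact[OF c] by auto
  moreover have "new_vertex s \<notin> neighbours s j"
    using new_vertex_fresh by (simp add: neighbours_def)
  ultimately show ?thesis
    using finite_neighbours by (simp add: vertex_degree_eq_card)
qed

text \<open>
All edges of an existing triangle are present.
\<close>

lemma vertex_degree_interact_triangle:
  assumes "t \<in># triangles s"
  shows "vertex_degree (interact t s) j = vertex_degree s j"
proof -
  have "t - {j} \<subseteq> neighbours s j" if "j \<in> t"
    using triangleD[OF assms] that by (auto simp: neighbours_def)
  then show ?thesis
    unfolding vertex_degree_eq_card neighbours_interact[OF triangleD(2)[OF assms]]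
    by (simp add: Un_absorb2)
qed

lemma valid_interact:
  assumes "t \<in> set_pmf (interacting p q r s)"
  shows "valid_state (Suc n) (interact t s)"
proof -
  note t = interacting_vertices[OF assms]
  have fin: "finite t" using t(2) card.infinite by fastforce
  have "\<exists>v. 0 \<le> v \<and> v \<le> int (Suc n) \<and> vertices s \<union> t = {-2..v}"
  proof (cases "new_vertex s \<in> t")
    case True
    then have "vertices s \<union> t = insert (new_vertex s) (vertices s)" using t(1) by auto
    also have "\<dots> = {-2..new_vertex s}"
      using new_vertex_properties by auto
    finally show ?thesis
      using new_vertex_properties by (intro exI[of _ "new_vertex s"]) auto
  next
    case False
    then have "vertices s \<union> t = vertices s" using t(1) by auto
    then show ?thesis
      using new_vertex_properties by (intro exI[of _ "new_vertex s - 1"]) auto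
  qed
  moreover have "size (mset_set (subsets_of_card 2 t)) = 3"
    using fin t(2) by (simp add: card_subsets_of_card choose_two)
  moreover have "size (filter_mset (\<lambda>e. j \<in> e) (mset_set (subsets_of_card 2 t))) = 2 * of_bool (j \<in> t)" for j
  proof (cases "j \<in> t")
    case True
    then show ?thesis
      using card_subsets_of_card_containing[OF fin True, of 2] t(2) fin
      by (simp add: filter_mset_mset_set)
  next
    case False
    then have "{e \<in> subsets_of_card 2 t. j \<in> e} = {}" by (auto simp: subsets_of_card_def)
    then show ?thesis using False fin by (simp add: filter_mset_mset_set)
  qed
  moreover have "{u, v} \<in># edges s + mset_set (subsets_of_card 2 t)" if "u \<in> t" "v \<in> t" "u \<noteq> v" for u v
    using that fin by (auto simp: subsets_of_card_def)
  ultimately show ?thesis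
    using valid t(2) fin vertex_weight_ge_1
    unfolding valid_state_def vertex_weight_interact
    by (auto simp: subsets_of_card_def)
qed

lemma valid_step: "s' \<in> set_pmf (step p q r s) \<Longrightarrow> valid_state (Suc n) s'"
  using valid_interact by (auto simp: step_def)

end

lemma valid_initial: "valid_state 0 initial_state"
proof -
  have [simp]: "{-2, 0} \<noteq> {-1, 0::int}" "{-2, -1} \<noteq> {-1, 0::int}" "{-2, -1} \<noteq> {-2, 0::int}"
    by (auto simp: doubleton_eq_iff)
  have w: "vertex_weight initial_state j = of_bool (j \<in> {-2, -1, 0})" for j
    by (simp add: vertex_weight_eq_size initial_state_def)
  show ?thesis
    unfolding valid_state_def w
    by (auto simp: initial_state_def insert_commute intro!: exI[of _ 0])
qed

section \<open>One-step expectations\<close>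

text \<open>
The probability that a given vertex takes part in an interaction by uniform choice is this rate divided
by the number of vertices.
\<close>

definition uniform_rate :: "real \<Rightarrow> real \<Rightarrow> real \<Rightarrow> real" where
  "uniform_rate p q r = 2 * p * (1 - r) + 3 * (1 - p) * (1 - q)"

lemma expectation_bind_bernoulli:
  fixes F :: "'b \<Rightarrow> real"
  assumes "0 \<le> p" "p \<le> 1" "\<And>b. finite (set_pmf (f b))"
  shows "measure_pmf.expectation (bind_pmf (bernoulli_pmf p) f) F =
    p * measure_pmf.expectation (f True) F + (1 - p) * measure_pmf.expectation (f False) F"
  using assms by (subst pmf_expectation_bind[of UNIV]) (auto simp: UNIV_bool)

lemma expectation_mono_finite:
  fixes F G :: "'b \<Rightarrow> real"
  assumes "finite (set_pmf P)" "\<And>x. x \<in> set_pmf P \<Longrightarrow> F x \<le> G x"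
  shows "measure_pmf.expectation P F \<le> measure_pmf.expectation P G"
  using assms by (intro integral_mono_AE integrable_measure_pmf_finite) (auto simp: AE_measure_pmf_iff)

lemma expectation_pmf_of_multiset_indicator:
  fixes c :: real
  assumes "A \<noteq> {#}"
  shows "measure_pmf.expectation (pmf_of_multiset A) (\<lambda>x. 1 + c * of_bool (P x)) =
    1 + c * (real (size (filter_mset P A)) / real (size A))"
proof -
  have sz: "real (size A) \<noteq> 0" using assms by simp
  have "size (filter_mset P A) = (\<Sum>x\<in>set_mset (filter_mset P A). count A x)"
    unfolding size_multiset_overloaded_eq by (intro sum.cong) auto
  also have "\<dots> = (\<Sum>x\<in>set_mset A. count A x * of_bool (P x))"
    by (intro sum.mono_neutral_cong_left) auto
  finally have *: "(\<Sum>x\<in>set_mset A. real (count A x) * of_bool (P x)) = real (size (filter_mset P A))"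
    by simp
  have "measure_pmf.expectation (pmf_of_multiset A) (\<lambda>x. 1 + c * of_bool (P x)) =
      (\<Sum>x\<in>set_mset A. (1 + c * of_bool (P x)) * (real (count A x) / real (size A)))"
    using assms by (subst integral_measure_pmf_real[of "set_mset A"]) auto
  also have "\<dots> = (\<Sum>x\<in>set_mset A. (real (count A x) + c * (real (count A x) * of_bool (P x))) / real (size A))"
    by (intro sum.cong) (auto simp: field_simps)
  also have "\<dots> = ((\<Sum>x\<in>set_mset A. real (count A x)) +
      c * (\<Sum>x\<in>set_mset A. real (count A x) * of_bool (P x))) / real (size A)"
    by (simp only: sum_divide_distrib sum.distrib sum_distrib_left add_divide_distrib)
  also have "(\<Sum>x\<in>set_mset A. real (count A x)) = real (size A)"
    by (simp add: size_multiset_overloaded_eq)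
  finally show ?thesis unfolding * using sz by (simp add: field_simps)
qed

lemma expectation_uniform_subset_indicator:
  fixes c :: real
  assumes "finite V" "j \<in> V" "0 < k" "k \<le> card V"
  shows "measure_pmf.expectation (pmf_of_set (subsets_of_card k V)) (\<lambda>A. 1 + c * of_bool (j \<in> A)) =
    1 + c * (real k / real (card V))"
proof -
  have card: "card (subsets_of_card k V) = card V choose k"
    using assms by (simp add: card_subsets_of_card)
  have pos: "0 < card V choose k" using assms(4) by simp
  have fin: "finite (subsets_of_card k V)" using assms by simp
  have ne: "subsets_of_card k V \<noteq> {}" using card pos by auto
  have "(\<Sum>A\<in>subsets_of_card k V. 1 + c * of_bool (j \<in> A)) =
      real (card (subsets_of_card k V)) + c * real (card {A \<in> subsets_of_card k V. j \<in> A})"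
    using fin by (simp add: sum.distrib sum_distrib_left[symmetric] Int_def)
  also have "\<dots> = real (card V choose k) + c * real ((card V - 1) choose (k - 1))"
    using assms by (simp add: card card_subsets_of_card_containing)
  finally have sum: "(\<Sum>A\<in>subsets_of_card k V. 1 + c * of_bool (j \<in> A)) = \<dots>" .
  have "k * (card V choose k) = card V * ((card V - 1) choose (k - 1))"
    using assms times_binomial_minus1_eq by simp
  then have "real k * real (card V choose k) = real (card V) * real ((card V - 1) choose (k - 1))"
    by (metis of_nat_mult)
  then have "real ((card V - 1) choose (k - 1)) / real (card V choose k) = real k / real (card V)"
    using pos assms by (auto simp: field_simps)
  then show ?thesis
    using pos by (simp add: integral_pmf_of_set[OF ne fin] sum card add_divide_distrib times_divide_eq_right[symmetric] del: times_divide_eq_right)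
qed

text \<open>
The four rules select the vertex \<open>j\<close> with probabilities \<open>2 W / (3 (n + 1))\<close> (weighted edge),
\<open>W / (n + 1)\<close> (weighted triangle), \<open>2 / V\<close> and \<open>3 / V\<close> (uniform pair and triple). A functional that
is at most 1 unless \<open>j\<close> interacts is therefore controlled by its excess over 1 under each rule.
Negative constants express that interactions of \<open>j\<close> decrease the mean.
\<close>

lemma expectation_step_le:
  fixes F :: "graph_state \<Rightarrow> real"
  assumes valid: "valid_state n s" and j: "j \<in> vertices s"
    and p: "0 \<le> p" "p \<le> 1" and q: "0 \<le> q" "q \<le> 1" and r: "0 \<le> r" "r \<le> 1"
    and edge: "\<And>e. e \<in># edges s \<Longrightarrow> F (interact (insert (new_vertex s) e) s) \<le> 1 + cE * of_bool (j \<in> e)"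
    and triangle: "\<And>t. t \<in># triangles s \<Longrightarrow> F (interact t s) \<le> 1 + cT * of_bool (j \<in> t)"
    and uniform: "\<And>t. t \<subseteq> insert (new_vertex s) (vertices s) \<Longrightarrow> card t = 3 \<Longrightarrow>
      F (interact t s) \<le> 1 + c * of_bool (j \<in> t)"
  shows "measure_pmf.expectation (step p q r s) F \<le>
    1 + (alpha2 p r * cE + alpha1 p q * cT) * (real (vertex_weight s j) / (real n + 1))
      + c * (uniform_rate p q r / real (card (vertices s)))"
proof -
  let ?V = "vertices s" and ?v = "new_vertex s" and ?W = "real (vertex_weight s j)"
  let ?E = "\<lambda>P G. measure_pmf.expectation P G :: real"
  define G where "G t = F (interact t s)" for t
  note V = finite_vertices[OF valid] card_vertices[OF valid]
  note ne = triangles_nonempty[OF valid] edges_nonempty[OF valid]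
  have jv: "j \<noteq> ?v" using j new_vertex_fresh[OF valid] by auto
  have S: "set_pmf (pmf_of_set (subsets_of_card k ?V)) = subsets_of_card k ?V"
    "finite (set_pmf (pmf_of_set (subsets_of_card k ?V)))" if "k \<le> 3" for k
  proof -
    have "card (subsets_of_card k ?V) > 0" using V that by (simp add: card_subsets_of_card)
    then have "subsets_of_card k ?V \<noteq> {}" by auto
    then show "set_pmf (pmf_of_set (subsets_of_card k ?V)) = subsets_of_card k ?V"
      "finite (set_pmf (pmf_of_set (subsets_of_card k ?V)))" using V by auto
  qed
  have fin: "finite (set_pmf (pmf_of_multiset (edges s)))" "finite (set_pmf (pmf_of_multiset (triangles s)))"
    using ne by simp_all
  have E1: "?E (pmf_of_multiset (edges s)) (\<lambda>e. G (insert ?v e)) \<le> 1 + cE * (2 * ?W / (3 * (real n + 1)))"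
  proof -
    have "?E (pmf_of_multiset (edges s)) (\<lambda>e. G (insert ?v e)) \<le>
        ?E (pmf_of_multiset (edges s)) (\<lambda>e. 1 + cE * of_bool (j \<in> e))"
      using ne edge by (intro expectation_mono_finite) (auto simp: G_def)
    also have "\<dots> = 1 + cE * (2 * ?W / (3 * (real n + 1)))"
      using ne by (simp add: expectation_pmf_of_multiset_indicator size_incident_edges[OF valid] sizes[OF valid] algebra_simps)
    finally show ?thesis .
  qed
  have E2: "?E (pmf_of_multiset (triangles s)) G \<le> 1 + cT * (?W / (real n + 1))"
  proof -
    have "?E (pmf_of_multiset (triangles s)) G \<le>
        ?E (pmf_of_multiset (triangles s)) (\<lambda>e. 1 + cT * of_bool (j \<in> e))"
      using ne triangle by (intro expectation_mono_finite) (auto simp: G_def)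
    also have "\<dots> = 1 + cT * (?W / (real n + 1))"
      using ne by (simp add: expectation_pmf_of_multiset_indicator vertex_weight_eq_size sizes[OF valid] algebra_simps)
    finally show ?thesis .
  qed
  have E3: "?E (pmf_of_set (subsets_of_card 2 ?V)) (\<lambda>e. G (insert ?v e)) \<le> 1 + c * (2 / card ?V)"
  proof -
    have "G (insert ?v A) \<le> 1 + c * of_bool (j \<in> A)" if "A \<in> subsets_of_card 2 ?V" for A
    proof -
      have A: "A \<subseteq> ?V" "card A = 2" using that by (auto simp: subsets_of_card_def)
      moreover have "finite A" using A(1) V(1) by (rule finite_subset)
      moreover have "?v \<notin> A" using A(1) new_vertex_fresh[OF valid] by auto
      ultimately have "insert ?v A \<subseteq> insert ?v ?V" "card (insert ?v A) = 3" by auto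
      from uniform[OF this] show ?thesis using jv by (simp add: G_def)
    qed
    then have "?E (pmf_of_set (subsets_of_card 2 ?V)) (\<lambda>e. G (insert ?v e)) \<le>
        ?E (pmf_of_set (subsets_of_card 2 ?V)) (\<lambda>A. 1 + c * of_bool (j \<in> A))"
      using S[of 2] by (intro expectation_mono_finite) auto
    then show ?thesis
      using expectation_uniform_subset_indicator[OF V(1) j, of 2 c] V(2) by simp
  qed
  have E4: "?E (pmf_of_set (subsets_of_card 3 ?V)) G \<le> 1 + c * (3 / card ?V)"
  proof -
    have "?E (pmf_of_set (subsets_of_card 3 ?V)) G \<le>
        ?E (pmf_of_set (subsets_of_card 3 ?V)) (\<lambda>A. 1 + c * of_bool (j \<in> A))"
    proof (rule expectation_mono_finite)
      fix t assume "t \<in> set_pmf (pmf_of_set (subsets_of_card 3 ?V))"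
      then have "t \<subseteq> insert ?v ?V" "card t = 3" using S[of 3] by (auto simp: subsets_of_card_def)
      then show "G t \<le> 1 + c * of_bool (j \<in> t)" unfolding G_def by (rule uniform)
    qed (use S[of 3] in simp)
    then show ?thesis
      using expectation_uniform_subset_indicator[OF V(1) j, of 3 c] V(2) by simp
  qed
  define P2 where "P2 = bind_pmf (bernoulli_pmf r) (\<lambda>preferential.
    if preferential then pmf_of_multiset (edges s) else pmf_of_set (subsets_of_card 2 ?V))"
  define P3 where "P3 = bind_pmf (bernoulli_pmf q) (\<lambda>preferential.
    if preferential then pmf_of_multiset (triangles s) else pmf_of_set (subsets_of_card 3 ?V))"
  have fin_P: "finite (set_pmf P2)" "finite (set_pmf P3)"
    using fin S by (auto simp: P2_def P3_def)
  have E_P2: "?E P2 H = r * ?E (pmf_of_multiset (edges s)) H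
      + (1 - r) * ?E (pmf_of_set (subsets_of_card 2 ?V)) H" for H
    unfolding P2_def using r fin S[of 2] by (subst expectation_bind_bernoulli) auto
  have E_P3: "?E P3 H = q * ?E (pmf_of_multiset (triangles s)) H
      + (1 - q) * ?E (pmf_of_set (subsets_of_card 3 ?V)) H" for H
    unfolding P3_def using q fin S[of 3] by (subst expectation_bind_bernoulli) auto
  have "?E (step p q r s) F = ?E (interacting p q r s) G"
    by (simp add: step_def G_def[abs_def])
  also have "\<dots> = p * (r * ?E (pmf_of_multiset (edges s)) (\<lambda>e. G (insert ?v e))
        + (1 - r) * ?E (pmf_of_set (subsets_of_card 2 ?V)) (\<lambda>e. G (insert ?v e)))
      + (1 - p) * (q * ?E (pmf_of_multiset (triangles s)) G
        + (1 - q) * ?E (pmf_of_set (subsets_of_card 3 ?V)) G)"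
    unfolding interacting_def P2_def[symmetric] P3_def[symmetric]
    using p fin_P by (subst expectation_bind_bernoulli) (auto simp: E_P2 E_P3)
  also have "\<dots> \<le> p * (r * (1 + cE * (2 * ?W / (3 * (real n + 1)))) + (1 - r) * (1 + c * (2 / card ?V)))
      + (1 - p) * (q * (1 + cT * (?W / (real n + 1))) + (1 - q) * (1 + c * (3 / card ?V)))"
    using p q r by (intro add_mono mult_left_mono E1 E2 E3 E4) auto
  also have "\<dots> = 1 + (alpha2 p r * cE + alpha1 p q * cT) * (?W / (real n + 1))
      + c * (uniform_rate p q r / real (card ?V))"
  proof -
    define w u where "w = ?W / (real n + 1)" and "u = 1 / real (card ?V)"
    have w: "2 * ?W / (3 * (real n + 1)) = 2 / 3 * w"
      by (simp add: w_def)
    have u: "2 / real (card ?V) = 2 * u" "3 / real (card ?V) = 3 * u"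
      "uniform_rate p q r / real (card ?V) = uniform_rate p q r * u"
      by (simp_all add: u_def)
    show ?thesis
      unfolding w u w_def[symmetric]
      by (simp add: alpha1_def alpha2_def uniform_rate_def field_simps)
  qed
  finally show ?thesis .
qed

text \<open>
The number of vertices grows by 1 with probability \<open>p\<close> and is unchanged otherwise.
\<close>

lemma expectation_step_new_vertex_le:
  assumes valid: "valid_state n s" and p: "0 < p" "p \<le> 1"
  shows "measure_pmf.expectation (step p q r s)
      (\<lambda>s'. exp (real (card (vertices s)) - real (card (vertices s')))) \<le> 1 - p * (1 - exp (- 1))"
proof -
  let ?V = "vertices s" and ?v = "new_vertex s"
  let ?E = "\<lambda>P G. measure_pmf.expectation P G :: real"
  define G where "G t = exp (real (card ?V) - real (card (?V \<union> t)))" for t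
  define f where "f b = (if b then
         map_pmf (insert (new_vertex s))
           (bind_pmf (bernoulli_pmf r) (\<lambda>preferential.
              if preferential then pmf_of_multiset (edges s)
              else pmf_of_set (subsets_of_card 2 (vertices s))))
       else
         bind_pmf (bernoulli_pmf q) (\<lambda>preferential.
           if preferential then pmf_of_multiset (triangles s)
           else pmf_of_set (subsets_of_card 3 (vertices s))))" for b
  have int: "interacting p q r s = bind_pmf (bernoulli_pmf p) f"
    by (simp add: interacting_def f_def[abs_def])
  have support: "set_pmf (f b) \<subseteq> set_pmf (interacting p q r s)" if "b \<or> p \<noteq> 1" for b
  proof -
    have "b \<in> set_pmf (bernoulli_pmf p)" using p that by (cases b) (simp_all add: set_pmf_iff)
    then show ?thesis unfolding int set_bind_pmf by blast
  qed
  have fin: "finite (set_pmf (f b))" if "b \<or> p \<noteq> 1" for b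
    using support[OF that] finite_interacting[OF valid] by (rule finite_subset)
  have T: "?E (f True) G \<le> exp (- 1)"
  proof -
    have "?E (f True) G \<le> ?E (f True) (\<lambda>_. exp (- 1))"
    proof (rule expectation_mono_finite)
      fix t assume t: "t \<in> set_pmf (f True)"
      then have "?v \<in> t" by (auto simp: f_def)
      moreover have "t \<subseteq> insert ?v ?V"
        using interacting_vertices(1)[OF valid subsetD[OF support[of True] t]] by simp
      ultimately have "?V \<union> t = insert ?v ?V" by auto
      then show "G t \<le> exp (- 1)"
        using new_vertex_fresh[OF valid] finite_vertices[OF valid] by (simp add: G_def)
    qed (use fin in simp)
    then show ?thesis by simp
  qed
  have F: "(1 - p) * ?E (f False) G \<le> 1 - p"
  proof (cases "p = 1")
    case False
    have "?E (f False) G \<le> ?E (f False) (\<lambda>_. 1)"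
    proof (rule expectation_mono_finite)
      fix t assume t: "t \<in> set_pmf (f False)"
      have "t \<subseteq> insert ?v ?V"
        using interacting_vertices(1)[OF valid subsetD[OF support[of False] t]] False by simp
      then have "finite (?V \<union> t)" using finite_vertices[OF valid] by (meson finite.insertI finite_UnI finite_subset)
      then have "card ?V \<le> card (?V \<union> t)" by (intro card_mono) auto
      then show "G t \<le> 1" by (simp add: G_def)
    qed (use fin False in simp)
    then show ?thesis using p mult_left_mono[of "?E (f False) G" 1 "1 - p"] by simp
  qed simp
  have "?E (step p q r s) (\<lambda>s'. exp (real (card ?V) - real (card (vertices s')))) = ?E (interacting p q r s) G"
    by (simp add: step_def G_def[abs_def])
  also have "\<dots> = p * ?E (f True) G + (1 - p) * ?E (f False) G"
  proof (cases "p = 1")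
    case True
    have "bernoulli_pmf p = return_pmf True" by (rule pmf_eqI) (simp add: True pmf_return indicator_def split: bool.splits)
    then show ?thesis unfolding int by (simp add: True bind_return_pmf)
  next
    case False
    then show ?thesis unfolding int using p fin by (subst expectation_bind_bernoulli) auto
  qed
  also have "\<dots> \<le> p * exp (- 1) + (1 - p)"
    using p T F by (intro add_mono mult_left_mono) auto
  finally show ?thesis by (simp add: algebra_simps)
qed

section \<open>Analytic preliminaries\<close>

text \<open>
A bound for the products of \<open>exp (f (m + 1) - f m)\<close> bounds \<open>f\<close>. The product need have this form only
from some time \<open>n0\<close> on, since the vertex under consideration may be born late.
\<close>

lemma telescoping_potential_bounded:
  fixes f y :: "nat \<Rightarrow> real"
  assumes pos: "\<And>m. 0 < y m"
    and y: "\<And>m. n0 \<le> m \<Longrightarrow> y m = exp (f (Suc m) - f m)"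
    and C: "\<And>n. (\<Prod>m<n. y m) \<le> C"
  shows "\<exists>B. \<forall>n. f n \<le> B"
proof -
  define P where "P = (\<Prod>m<n0. y m)"
  have P: "0 < P" using pos by (auto simp: P_def intro: prod_pos)
  have prod: "(\<Prod>m<n. y m) = P * exp (f n - f n0)" if "n0 \<le> n" for n
    using that
  proof (induction n rule: dec_induct)
    case (step n)
    then show ?case by (simp add: y mult_exp_exp)
  qed (simp add: P_def)
  have "f n \<le> max (Max (f ` {..n0})) (f n0 + ln (C / P))" for n
  proof (cases "n0 \<le> n")
    case True
    have "exp (f n - f n0) \<le> C / P"
      using C[of n] prod[OF True] P by (simp add: field_simps)
    moreover from this have "0 < C / P" by (rule less_le_trans[OF exp_gt_zero])
    ultimately have "f n - f n0 \<le> ln (C / P)" by (simp add: ln_ge_iff)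
    then show ?thesis by simp
  qed (auto simp: le_max_iff_disj intro!: Max_ge)
  then show ?thesis by blast
qed

lemma sum_inverse_Suc_le_ln:
  assumes "1 \<le> i" "i \<le> n"
  shows "(\<Sum>m=i..<n. 1 / real (Suc m)) \<le> ln (real n / real i)"
  using assms(2)
proof (induction n rule: dec_induct)
  case (step n)
  have n: "0 < real n" using step assms by simp
  have "ln (real n / real (Suc n)) \<le> real n / real (Suc n) - 1"
    using n by (intro ln_le_minus_one) simp
  then have "1 / real (Suc n) \<le> ln (real (Suc n)) - ln (real n)"
    using n by (simp add: ln_div field_simps)
  then show ?case
    using step assms by (simp add: ln_div)
qed (use assms in simp)

lemma log_over_power_tendsto_0:
  fixes S x c a :: real
  assumes "0 < x" "0 < c" "0 < a"
  shows "(\<lambda>n. (S + ln (real n / x) / c) / real n powr a) \<longlonglongrightarrow> 0"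
  using assms by real_asymp

lemma pochhammer_ge_power:
  fixes x :: real
  assumes "0 \<le> x"
  shows "x ^ k \<le> pochhammer x k"
proof (induction k)
  case (Suc k)
  have "x ^ k * x \<le> pochhammer x k * (x + real k)"
    using Suc assms by (intro mult_mono) (auto intro: order_trans[of 0 "x ^ k"])
  then show ?case by (simp add: pochhammer_Suc mult.commute)
qed simp

lemma pochhammer_shift_ratio:
  fixes x :: real
  assumes "0 < x"
  shows "pochhammer (x + 1) k / pochhammer x k = 1 + real k / x"
proof -
  have "x * pochhammer (x + 1) k = pochhammer x k * (x + real k)"
    by (metis pochhammer_Suc pochhammer_rec)
  then show ?thesis
    using assms pochhammer_pos[OF assms, of k] by (simp add: field_simps)
qed

section \<open>Exponential supermartingales of the interaction process\<close>

locale interaction_process = pmf_chain M G "step p q r" initial_state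
  for p q r :: real and M :: "'a measure" and G :: "nat \<Rightarrow> 'a \<Rightarrow> graph_state" +
  assumes p: "0 < p" "p \<le> 1" and q: "0 \<le> q" "q \<le> 1" and r: "0 \<le> r" "r \<le> 1"
begin

abbreviation \<alpha>1 :: real where "\<alpha>1 \<equiv> alpha1 p q"
abbreviation \<alpha>2 :: real where "\<alpha>2 \<equiv> alpha2 p r"
abbreviation \<alpha> :: real where "\<alpha> \<equiv> alpha p q r"
abbreviation \<beta> :: real where "\<beta> \<equiv> uniform_rate p q r"
abbreviation "W s j \<equiv> real (vertex_weight s j)"
abbreviation "D s j \<equiv> real (vertex_degree s j)"
abbreviation "V s \<equiv> real (card (vertices s))"

definition trajectory :: "(nat \<Rightarrow> graph_state) \<Rightarrow> bool" where
  "trajectory g \<longleftrightarrow> g 0 = initial_state \<and> (\<forall>n. g (Suc n) \<in> set_pmf (step p q r (g n)))"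

lemma AE_trajectory: "AE \<omega> in M. trajectory (\<lambda>n. G n \<omega>)"
  using AE_transitions by (simp add: trajectory_def)

lemma trajectory_valid: "trajectory g \<Longrightarrow> valid_state n (g n)"
  by (induction n) (auto simp: trajectory_def valid_initial intro: valid_step)

lemma rates: "0 \<le> \<alpha>1" "0 \<le> \<alpha>2" "0 \<le> \<alpha>" "0 \<le> \<beta>" "\<alpha> = \<alpha>1 + \<alpha>2"
  using p q r by (auto simp: alpha1_def alpha2_def alpha_def uniform_rate_def)

lemma step_obtain:
  assumes "s' \<in> set_pmf (step p q r s)"
  obtains t where "s' = interact t s"
  using assms by (auto simp: step_def)

lemma finite_step: "valid_state n s \<Longrightarrow> finite (set_pmf (step p q r s))"
  using finite_interacting by (auto simp: step_def)

lemma nn_integral_step_le_1: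
  assumes "valid_state n s" "\<And>s'. 0 \<le> F s'" "measure_pmf.expectation (step p q r s) F \<le> 1"
  shows "(\<integral>\<^sup>+s'. ennreal (F s') \<partial>step p q r s) \<le> 1"
  using assms(2,3) finite_step[OF assms(1)]
  by (subst nn_integral_eq_integral) (auto intro: integrable_measure_pmf_finite simp: ennreal_le_1)

text \<open>
If \<open>c\<close> dominates the logarithm of the conditional mean of \<open>exp (\<Phi> s' - \<Phi> s)\<close>, then
\<open>exp (\<Phi> - \<Sum> c)\<close> is a product of factors with conditional mean at most 1, so \<open>\<Phi>\<close> exceeds the
accumulated \<open>c\<close> by at most a random constant. The factors are set to 1 until the persistent
property \<open>alive\<close> holds.
\<close>

lemma AE_potential_bounded:
  fixes \<Phi> c :: "graph_state \<Rightarrow> real"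
  assumes E: "\<And>n s. valid_state n s \<Longrightarrow> alive s \<Longrightarrow>
      measure_pmf.expectation (step p q r s) (\<lambda>s'. exp (\<Phi> s' - \<Phi> s)) \<le> exp (c s)"
    and alive: "\<And>s s'. alive s \<Longrightarrow> s' \<in> set_pmf (step p q r s) \<Longrightarrow> alive s'"
  shows "AE \<omega> in M. (\<exists>n. alive (G n \<omega>)) \<longrightarrow>
    (\<exists>C. \<forall>n. \<Phi> (G n \<omega>) \<le> C + (\<Sum>m<n. c (G m \<omega>)))"
proof -
  define y :: "nat \<Rightarrow> graph_state \<Rightarrow> graph_state \<Rightarrow> real" where
    "y n s s' = (if alive s then exp (\<Phi> s' - \<Phi> s - c s) else 1)" for n s s'
  have "(\<integral>\<^sup>+s'. ennreal (y n s s') \<partial>step p q r s) \<le> 1" if "valid_state n s" for n s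
  proof (rule nn_integral_step_le_1[OF that])
    have "measure_pmf.expectation (step p q r s) (\<lambda>s'. exp (\<Phi> s' - \<Phi> s) * exp (- c s)) \<le> 1" if "alive s"
      using E[OF \<open>valid_state n s\<close> that] by (simp add: exp_minus field_simps)
    then show "measure_pmf.expectation (step p q r s) (y n s) \<le> 1"
      by (cases "alive s") (simp_all add: y_def[abs_def] mult_exp_exp)
  qed (simp add: y_def)
  then have "AE \<omega> in M. \<exists>C. \<forall>n. (\<Prod>m<n. y m (G m \<omega>) (G (Suc m) \<omega>)) \<le> C"
    by (intro AE_bounded[where I = valid_state] valid_initial valid_step) (auto simp: y_def)
  with AE_trajectory show ?thesis
  proof eventually_elim
    case (elim \<omega>)
    from elim(2) obtain C where C: "\<And>n. (\<Prod>m<n. y m (G m \<omega>) (G (Suc m) \<omega>)) \<le> C" by blast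
    show ?case
    proof
      assume "\<exists>n. alive (G n \<omega>)"
      then obtain n0 where n0: "alive (G n0 \<omega>)" by blast
      have al: "alive (G m \<omega>)" if "n0 \<le> m" for m
        using that
      proof (induction m rule: dec_induct)
        case (step m)
        then show ?case
          using alive elim(1) unfolding trajectory_def by blast
      qed (fact n0)
      define f where "f n = \<Phi> (G n \<omega>) - (\<Sum>m<n. c (G m \<omega>))" for n
      have "\<exists>B. \<forall>n. f n \<le> B"
        by (rule telescoping_potential_bounded[where ?n0.0 = n0, OF _ _ C]) (auto simp: y_def f_def al)
      then obtain B where B: "\<And>n. f n \<le> B" by blast
      have "\<Phi> (G n \<omega>) \<le> B + (\<Sum>m<n. c (G m \<omega>))" for n
        using B[of n] by (simp add: f_def)
      then show "\<exists>C. \<forall>n. \<Phi> (G n \<omega>) \<le> C + (\<Sum>m<n. c (G m \<omega>))" by blast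
    qed
  qed
qed

lemma vertices_step: "s' \<in> set_pmf (step p q r s) \<Longrightarrow> vertices s \<subseteq> vertices s'"
  by (auto elim: step_obtain)

text \<open>
The potential is minus the number of vertices; each step multiplies the mean of its exponential by at
most \<open>\<theta> = 1 - p (1 - 1 / e) < 1\<close>, so the number of vertices grows at least like \<open>- n ln \<theta>\<close>. Half
of this slope absorbs the random constant.
\<close>

lemma AE_vertices_linear:
  obtains c where "0 < c" "AE \<omega> in M. \<forall>\<^sub>F n in sequentially. c * (real n + 1) \<le> V (G n \<omega>)"
proof
  define \<theta> where "\<theta> = 1 - p * (1 - exp (- 1))"
  have e: "0 < 1 - exp (- 1 :: real)" "1 - exp (- 1 :: real) < 1" by simp_all
  have "p * (1 - exp (- 1)) \<le> 1 - exp (- 1)" using p e by (intro mult_left_le_one_le) auto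
  then have "p * (1 - exp (- 1)) < 1" using e by linarith
  moreover have "0 < p * (1 - exp (- 1))" using p e by (intro mult_pos_pos)
  ultimately have \<theta>: "0 < \<theta>" "\<theta> < 1" by (auto simp: \<theta>_def)
  then have ln: "ln \<theta> < 0" by simp
  then show "0 < - ln \<theta> / 2" by simp
  have "AE \<omega> in M. (\<exists>n::nat. True) \<longrightarrow> (\<exists>C. \<forall>n. - V (G n \<omega>) \<le> C + (\<Sum>m<n. ln \<theta>))"
    using expectation_step_new_vertex_le[OF _ p] \<theta>
    by (intro AE_potential_bounded[where alive = "\<lambda>_. True"]) (simp_all add: \<theta>_def)
  then show "AE \<omega> in M. \<forall>\<^sub>F n in sequentially. - ln \<theta> / 2 * (real n + 1) \<le> V (G n \<omega>)"
  proof eventually_elim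
    case (elim \<omega>)
    then obtain C where C: "\<And>n. - V (G n \<omega>) \<le> C + real n * ln \<theta>" by auto
    have "\<forall>\<^sub>F n in sequentially. nat \<lceil>1 + 2 * C / (- ln \<theta>)\<rceil> \<le> n"
      by (rule eventually_ge_at_top)
    then show ?case
    proof eventually_elim
      case (elim n)
      then have "1 + 2 * C / (- ln \<theta>) \<le> real n" by linarith
      then have "2 * C - ln \<theta> \<le> - ln \<theta> * real n" using ln by (simp add: field_simps)
      moreover have "- ln \<theta> / 2 * (real n + 1) = - ln \<theta> / 2 - real n * ln \<theta> / 2"
        by (simp add: field_simps)
      ultimately show ?case using C[of n] by (simp add: mult.commute)
    qed
  qed
qed

text \<open>
The potential is \<open>a D - b W\<close>. The assumption says that its exponential does not increase in mean
under the two weighted rules; the uniform rules change the exponent by at most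
\<open>2 \<bar>a\<bar> + \<bar>b\<bar>\<close> and cost \<open>K / V\<close> per step.
\<close>

lemma AE_degree_weight_bound:
  assumes ab: "\<alpha>2 * (exp (a - b) - 1) + \<alpha>1 * (exp (- b) - 1) \<le> 0"
  shows "\<exists>K. \<forall>j. AE \<omega> in M. (\<exists>n. j \<in> vertices (G n \<omega>)) \<longrightarrow>
    (\<exists>C. \<forall>n. a * D (G n \<omega>) j - b * W (G n \<omega>) j \<le> C + (\<Sum>m<n. K / V (G m \<omega>)))"
proof (intro exI allI)
  define K where "K = exp (2 * \<bar>a\<bar> + \<bar>b\<bar>)"
  show "AE \<omega> in M. (\<exists>n. j \<in> vertices (G n \<omega>)) \<longrightarrow>
      (\<exists>C. \<forall>n. a * D (G n \<omega>) j - b * W (G n \<omega>) j \<le> C + (\<Sum>m<n. K * \<beta> / V (G m \<omega>)))" for j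
  proof (rule AE_potential_bounded)
    fix n s assume valid: "valid_state n s" and j: "j \<in> vertices s"
    define F where "F s' = exp (a * D s' j - b * W s' j - (a * D s j - b * W s j))" for s'
    have "measure_pmf.expectation (step p q r s) F \<le>
        1 + (\<alpha>2 * (exp (a - b) - 1) + \<alpha>1 * (exp (- b) - 1)) * (W s j / (real n + 1)) + K * (\<beta> / V s)"
    proof (rule expectation_step_le[OF valid j])
      fix e assume e: "e \<in># edges s"
      have "j \<noteq> new_vertex s" using j new_vertex_fresh[OF valid] by auto
      then show "F (interact (insert (new_vertex s) e) s) \<le> 1 + (exp (a - b) - 1) * of_bool (j \<in> e)"
        by (simp add: F_def vertex_weight_interact vertex_degree_interact_edge[OF valid e j] algebra_simps)
    next
      fix t assume t: "t \<in># triangles s"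
      show "F (interact t s) \<le> 1 + (exp (- b) - 1) * of_bool (j \<in> t)"
        by (simp add: F_def vertex_weight_interact vertex_degree_interact_triangle[OF valid t] algebra_simps)
    next
      fix t assume t: "t \<subseteq> insert (new_vertex s) (vertices s)" "card t = 3"
      define d where "d = D (interact t s) j - D s j"
      have d: "0 \<le> d" "d \<le> 2 * of_bool (j \<in> t)"
        using vertex_degree_interact[OF valid t(2), of j] by (auto simp: d_def split: if_splits)
      have F: "F (interact t s) = exp (a * d - b * of_bool (j \<in> t))"
        by (simp add: F_def d_def vertex_weight_interact algebra_simps)
      show "F (interact t s) \<le> 1 + K * of_bool (j \<in> t)"
      proof (cases "j \<in> t")
        case True
        have "a * d \<le> \<bar>a\<bar> * 2" using d True by (intro order_trans[OF mult_right_mono mult_left_mono]) auto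
        then have "F (interact t s) \<le> K" by (simp add: F K_def True)
        then show ?thesis using True by simp
      next
        case False
        then show ?thesis using d by (simp add: F)
      qed
    qed (use p q r in auto)
    also have "\<dots> \<le> 1 + K * \<beta> / V s"
      using mult_right_mono[OF ab, of "W s j / (real n + 1)"] by simp
    also have "\<dots> \<le> exp (K * \<beta> / V s)" by (rule exp_ge_add_one_self)
    finally show "measure_pmf.expectation (step p q r s)
        (\<lambda>s'. exp (a * D s' j - b * W s' j - (a * D s j - b * W s j))) \<le> exp (K * \<beta> / V s)"
      by (simp add: F_def[abs_def])
  next
    fix s s' assume "j \<in> vertices s" "s' \<in> set_pmf (step p q r s)"
    then show "j \<in> vertices s'" using vertices_step by blast
  qed
qed

text \<open>
Without weighted choices a vertex is chosen with probability \<open>\<beta> / V \<ge> \<beta> / (n + 3)\<close>, and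
this harmonic series diverges. The potential \<open>- W\<close> turns the divergence into a lower bound for the
weight. The vertex 0 serves because it exists from the start.
\<close>

lemma AE_weight_unbounded_if_alpha_0:
  assumes "\<alpha> = 0"
  shows "AE \<omega> in M. filterlim (\<lambda>n. W (G n \<omega>) 0) at_top sequentially"
proof -
  define \<kappa> where "\<kappa> = (1 - exp (- 1)) * \<beta>"
  have zero: "\<alpha>1 = 0" "\<alpha>2 = 0" using rates assms by auto
  then have "r = 0" using p by (auto simp: alpha2_def)
  then have "2 * p \<le> \<beta>" using p q by (simp add: uniform_rate_def)
  then have \<kappa>: "0 < \<kappa>" using p by (simp add: \<kappa>_def)
  have "AE \<omega> in M. (\<exists>n. 0 \<in> vertices (G n \<omega>)) \<longrightarrow>
      (\<exists>C. \<forall>n. - W (G n \<omega>) 0 \<le> C + (\<Sum>m<n. - \<kappa> / V (G m \<omega>)))"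
  proof (rule AE_potential_bounded)
    fix n s assume valid: "valid_state n s" and j: "0 \<in> vertices s"
    have "measure_pmf.expectation (step p q r s) (\<lambda>s'. exp (- W s' 0 - - W s 0)) \<le>
        1 + (\<alpha>2 * (exp (- 1) - 1) + \<alpha>1 * (exp (- 1) - 1)) * (W s 0 / (real n + 1)) + (exp (- 1) - 1) * (\<beta> / V s)"
    proof (rule expectation_step_le[OF valid j])
      fix e assume e: "e \<in># edges s"
      have "0 \<noteq> new_vertex s" using j new_vertex_fresh[OF valid] by auto
      then show "exp (- W (interact (insert (new_vertex s) e) s) 0 - - W s 0) \<le> 1 + (exp (- 1) - 1) * of_bool (0 \<in> e)"
        by (simp add: vertex_weight_interact)
    qed (use p q r in \<open>auto simp: vertex_weight_interact\<close>)
    also have "\<dots> = 1 + (- \<kappa> / V s)"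
      by (simp add: zero \<kappa>_def algebra_simps diff_divide_distrib)
    also have "\<dots> \<le> exp (- \<kappa> / V s)" by (rule exp_ge_add_one_self)
    finally show "measure_pmf.expectation (step p q r s) (\<lambda>s'. exp (- W s' 0 - - W s 0)) \<le> exp (- \<kappa> / V s)" .
  next
    fix s s' assume "0 \<in> vertices s" "s' \<in> set_pmf (step p q r s)"
    then show "0 \<in> vertices s'" using vertices_step by blast
  qed
  with AE_trajectory show ?thesis
  proof eventually_elim
    case (elim \<omega>)
    note valid = trajectory_valid[OF elim(1)]
    obtain C where C: "\<And>n. - W (G n \<omega>) 0 \<le> C + (\<Sum>m<n. - \<kappa> / V (G m \<omega>))"
      using elim(2) initial_vertices[OF valid] by blast
    have "\<kappa> * (ln (real n + 3) - ln 3) \<le> C + W (G n \<omega>) 0" for n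
    proof -
      have "ln (real n + 3) - ln 3 \<le> (\<Sum>m<n. 1 / (real m + 3))"
      proof (induction n)
        case (Suc n)
        have "ln ((real n + 4) / (real n + 3)) \<le> (real n + 4) / (real n + 3) - 1"
          by (intro ln_le_minus_one) simp
        then have "ln (real n + 4) - ln (real n + 3) \<le> 1 / (real n + 3)"
          by (simp add: ln_div field_simps)
        with Suc show ?case by (simp add: add_ac)
      qed simp
      also have "\<dots> \<le> (\<Sum>m<n. 1 / V (G m \<omega>))"
      proof (rule sum_mono)
        fix m
        have "3 \<le> V (G m \<omega>)" "V (G m \<omega>) \<le> real m + 3"
          using card_vertices[OF valid[of m]] by linarith+
        then show "1 / (real m + 3) \<le> 1 / V (G m \<omega>)" by (intro divide_left_mono) auto
      qed
      finally have "\<kappa> * (ln (real n + 3) - ln 3) \<le> \<kappa> * (\<Sum>m<n. 1 / V (G m \<omega>))"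
        using \<kappa> by simp
      also have "\<dots> = - (\<Sum>m<n. - \<kappa> / V (G m \<omega>))" by (simp add: sum_distrib_left sum_negf)
      finally show ?thesis using C[of n] by simp
    qed
    then have le: "\<kappa> * (ln (real n + 3) - ln 3) - C \<le> W (G n \<omega>) 0" for n by (simp add: algebra_simps)
    have lim: "filterlim (\<lambda>n. \<kappa> * (ln (real n + 3) - ln 3) - C) at_top sequentially"
      using \<kappa> by real_asymp
    show ?case
      by (rule filterlim_at_top_mono[OF lim]) (use le in simp)
  qed
qed

text \<open>
The number of vertices grows linearly, so the sum is \<open>O(log n)\<close>.
\<close>

lemma AE_sum_inverse_vertices_negligible:
  assumes "0 < \<alpha>"
  shows "AE \<omega> in M. (\<lambda>n. (\<Sum>m<n. 1 / V (G m \<omega>)) / real n powr \<alpha>) \<longlonglongrightarrow> 0"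
proof -
  obtain c where c: "0 < c" "AE \<omega> in M. \<forall>\<^sub>F n in sequentially. c * (real n + 1) \<le> V (G n \<omega>)"
    by (rule AE_vertices_linear)
  from c(2) show ?thesis
  proof eventually_elim
    case (elim \<omega>)
    then obtain N where N: "\<And>n. N \<le> n \<Longrightarrow> c * (real n + 1) \<le> V (G n \<omega>)"
      by (auto simp: eventually_sequentially)
    define i where "i = Suc N"
    define S where "S = (\<Sum>m<i. 1 / V (G m \<omega>))"
    have "(\<Sum>m<n. 1 / V (G m \<omega>)) \<le> S + ln (real n / real i) / c" if n: "i \<le> n" for n
    proof -
      have "(\<Sum>m=i..<n. 1 / V (G m \<omega>)) \<le> (\<Sum>m=i..<n. 1 / (c * real (Suc m)))"
      proof (rule sum_mono)
        fix m assume "m \<in> {i..<n}"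
        then have "c * real (Suc m) \<le> V (G m \<omega>)" using N[of m] by (simp add: i_def algebra_simps)
        moreover have "0 < c * real (Suc m)" using c by simp
        ultimately show "1 / V (G m \<omega>) \<le> 1 / (c * real (Suc m))"
          by (intro divide_left_mono) auto
      qed
      also have "\<dots> = (\<Sum>m=i..<n. 1 / real (Suc m)) / c"
        by (simp add: sum_divide_distrib mult.commute)
      also have "\<dots> \<le> ln (real n / real i) / c"
        using c n by (intro divide_right_mono sum_inverse_Suc_le_ln) (auto simp: i_def)
      finally have "(\<Sum>m=i..<n. 1 / V (G m \<omega>)) \<le> ln (real n / real i) / c" .
      moreover have "(\<Sum>m<n. 1 / V (G m \<omega>)) = S + (\<Sum>m=i..<n. 1 / V (G m \<omega>))"
        using n by (simp add: S_def lessThan_atLeast0 sum.atLeastLessThan_concat)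
      ultimately show ?thesis by simp
    qed
    then have upper: "\<forall>\<^sub>F n in sequentially. (\<Sum>m<n. 1 / V (G m \<omega>)) / real n powr \<alpha> \<le>
        (S + ln (real n / real i) / c) / real n powr \<alpha>"
      by (intro eventually_sequentiallyI[of i] divide_right_mono) auto
    have "(\<lambda>n. (S + ln (real n / real i) / c) / real n powr \<alpha>) \<longlonglongrightarrow> 0"
      using assms c by (intro log_over_power_tendsto_0) (auto simp: i_def)
    from _ upper tendsto_const this show ?case
      by (rule tendsto_sandwich) (auto intro!: always_eventually divide_nonneg_nonneg sum_nonneg)
  qed
qed

section \<open>The degree of a fixed vertex\<close>

text \<open>
The \<open>b\<close> that solves \<open>\<alpha>\<^sub>2 e\<^sup>a + \<alpha>\<^sub>1 = \<alpha> e\<^sup>b\<close>: the logarithmic moment generating function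
of a Bernoulli variable with success probability \<open>\<alpha>\<^sub>2 / \<alpha>\<close>, the conditional probability that a
weighted choice of the vertex brings a new neighbour.
\<close>

definition slope :: "real \<Rightarrow> real" where
  "slope a = ln ((\<alpha>2 * exp a + \<alpha>1) / \<alpha>)"

lemma slope_identity:
  assumes "0 < \<alpha>"
  shows "\<alpha>2 * (exp (a - slope a) - 1) + \<alpha>1 * (exp (- slope a) - 1) = 0"
proof -
  have "0 < \<alpha>2 * exp a + \<alpha>1"
    using assms rates by (cases "\<alpha>2 = 0") (auto intro: add_pos_nonneg)
  then have "exp (slope a) = (\<alpha>2 * exp a + \<alpha>1) / \<alpha>" and ne: "\<alpha>2 * exp a + \<alpha>1 \<noteq> 0"
    using assms by (auto simp: slope_def)
  then have "exp (- slope a) * (\<alpha>2 * exp a + \<alpha>1) = \<alpha>"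
    using assms by (simp add: exp_minus)
  moreover have "exp (a - slope a) = exp a * exp (- slope a)"
    by (simp add: exp_diff exp_minus field_simps)
  ultimately have "\<alpha>2 * (exp (a - slope a) - 1) + \<alpha>1 * (exp (- slope a) - 1) = \<alpha> - (\<alpha>1 + \<alpha>2)"
    by (simp add: algebra_simps)
  then show ?thesis using rates(5) by simp
qed

text \<open>
The derivative of \<open>slope\<close> at 0 is the mean of the Bernoulli variable.
\<close>

lemma slope_tendsto:
  assumes "0 < \<alpha>"
  shows "((\<lambda>a. slope a / a) \<longlongrightarrow> \<alpha>2 / \<alpha>) (at 0)"
proof -
  have "(slope has_real_derivative \<alpha>2 / \<alpha>) (at 0)"
    unfolding slope_def[abs_def] using assms rates(5)
    by (auto intro!: derivative_eq_intros simp: add.commute)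
  moreover have "slope 0 = 0" using assms rates(5) by (simp add: slope_def add.commute)
  ultimately show ?thesis by (simp add: has_field_derivative_iff)
qed

text \<open>
With \<open>a = 1 / (l + 1)\<close> the bound \<open>a D \<le> slope a * W + O(log n)\<close> is an upper bound for the
degree with factor \<open>slope a / a\<close>, and with \<open>a = - 1 / (l + 1)\<close> a lower bound. Countably many \<open>a\<close>
suffice, so that the exceptional null sets can be united. Positivity of the limit \<open>\<zeta>\<close> guarantees
that the vertex is born.
\<close>

lemma AE_degree_growth:
  assumes \<alpha>: "0 < \<alpha>" and \<zeta>_pos: "AE \<omega> in M. 0 < \<zeta> \<omega>"
    and W_lim: "AE \<omega> in M. (\<lambda>n. W (G n \<omega>) j / real n powr \<alpha>) \<longlonglongrightarrow> \<zeta> \<omega>"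
  shows "AE \<omega> in M. (\<lambda>n. D (G n \<omega>) j / real n powr \<alpha>) \<longlonglongrightarrow> \<alpha>2 / \<alpha> * \<zeta> \<omega>"
proof -
  define a where "a \<sigma> l = (if \<sigma> then 1 else - 1) / real (Suc l)" for \<sigma> :: bool and l :: nat
  have bound: "AE \<omega> in M. \<forall>\<sigma> l. \<exists>K C. \<forall>n. a \<sigma> l * D (G n \<omega>) j - slope (a \<sigma> l) * W (G n \<omega>) j
      \<le> C + K * (\<Sum>m<n. 1 / V (G m \<omega>))"
    unfolding AE_all_countable
  proof (intro allI)
    fix \<sigma> l
    obtain K where K: "\<forall>j. AE \<omega> in M. (\<exists>n. j \<in> vertices (G n \<omega>)) \<longrightarrow>
       (\<exists>C. \<forall>n. a \<sigma> l * D (G n \<omega>) j - slope (a \<sigma> l) * W (G n \<omega>) j \<le> C + (\<Sum>m<n. K / V (G m \<omega>)))"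
      using AE_degree_weight_bound[OF eq_refl[OF slope_identity[OF \<alpha>, of "a \<sigma> l"]]] by blast
    from K[rule_format, of j] AE_trajectory W_lim \<zeta>_pos
    show "AE \<omega> in M. \<exists>K C. \<forall>n. a \<sigma> l * D (G n \<omega>) j - slope (a \<sigma> l) * W (G n \<omega>) j
      \<le> C + K * (\<Sum>m<n. 1 / V (G m \<omega>))"
    proof eventually_elim
      case (elim \<omega>)
      have "\<forall>\<^sub>F n in sequentially. 0 < W (G n \<omega>) j / real n powr \<alpha>"
        using elim by (intro order_tendstoD(1))
      from eventually_happens'[OF sequentially_bot this]
      obtain n where "0 < W (G n \<omega>) j / real n powr \<alpha>" by blast
      then have "vertex_weight (G n \<omega>) j \<noteq> 0" by (intro notI) simp
      then have "j \<in> vertices (G n \<omega>)"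
        using vertex_weight_unborn[OF trajectory_valid[OF elim(2)], of j n] by (rule contrapos_np)
      with elim(1) show ?case by (auto simp: sum_distrib_left)
    qed
  qed
  from bound AE_sum_inverse_vertices_negligible[OF \<alpha>] W_lim \<zeta>_pos show ?thesis
  proof eventually_elim
    case (elim \<omega>)
    define d where "d n = D (G n \<omega>) j / real n powr \<alpha>" for n
    have a_ne: "a \<sigma> l \<noteq> 0" for \<sigma> l by (simp add: a_def)
    have R0: "\<exists>R. R \<longlonglongrightarrow> slope (a \<sigma> l) * \<zeta> \<omega> \<and> (\<forall>\<^sub>F n in sequentially. a \<sigma> l * d n \<le> R n)" for \<sigma> l
    proof -
      obtain K C where KC: "\<And>n. a \<sigma> l * D (G n \<omega>) j - slope (a \<sigma> l) * W (G n \<omega>) j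
          \<le> C + K * (\<Sum>m<n. 1 / V (G m \<omega>))"
        using elim(1) by blast
      define R where "R n = slope (a \<sigma> l) * (W (G n \<omega>) j / real n powr \<alpha>) + C / real n powr \<alpha>
          + K * ((\<Sum>m<n. 1 / V (G m \<omega>)) / real n powr \<alpha>)" for n
      have "(\<lambda>n. C / real n powr \<alpha>) \<longlonglongrightarrow> 0" using \<alpha> by real_asymp
      then have "R \<longlonglongrightarrow> slope (a \<sigma> l) * \<zeta> \<omega> + 0 + K * 0"
        unfolding R_def by (intro tendsto_intros elim(2,3))
      moreover have "a \<sigma> l * d n \<le> R n" if "0 < n" for n
      proof -
        have pos: "0 < real n powr \<alpha>" using that by simp
        have "a \<sigma> l * D (G n \<omega>) j \<le> slope (a \<sigma> l) * W (G n \<omega>) j + C + K * (\<Sum>m<n. 1 / V (G m \<omega>))"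
          using KC[of n] by simp
        from divide_right_mono[OF this, of "real n powr \<alpha>"] pos show ?thesis
          by (simp add: d_def R_def add_divide_distrib)
      qed
      then have "\<forall>\<^sub>F n in sequentially. a \<sigma> l * d n \<le> R n"
        using eventually_gt_at_top[of 0] by (rule eventually_mono[rotated])
      ultimately show ?thesis by auto
    qed
    have R: "\<exists>R. R \<longlonglongrightarrow> slope (a \<sigma> l) / a \<sigma> l * \<zeta> \<omega> \<and>
        (\<forall>\<^sub>F n in sequentially. if \<sigma> then d n \<le> R n else R n \<le> d n)" for \<sigma> l
    proof -
      obtain R where R: "R \<longlonglongrightarrow> slope (a \<sigma> l) * \<zeta> \<omega>" "\<forall>\<^sub>F n in sequentially. a \<sigma> l * d n \<le> R n"
        using R0[of \<sigma> l] by blast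
      have "(\<lambda>n. R n / a \<sigma> l) \<longlonglongrightarrow> slope (a \<sigma> l) * \<zeta> \<omega> / a \<sigma> l"
        using R(1) a_ne by (intro tendsto_intros)
      moreover have "\<forall>\<^sub>F n in sequentially. if \<sigma> then d n \<le> R n / a \<sigma> l else R n / a \<sigma> l \<le> d n"
        using R(2) by eventually_elim (auto simp: a_def field_simps)
      ultimately show ?thesis by (intro exI[of _ "\<lambda>n. R n / a \<sigma> l"]) simp
    qed
    have a_lim: "filterlim (a \<sigma>) (at 0) sequentially" for \<sigma>
      unfolding filterlim_at a_def by (cases \<sigma>; simp; real_asymp)
    have lim: "(\<lambda>l. slope (a \<sigma> l) / a \<sigma> l * \<zeta> \<omega>) \<longlonglongrightarrow> \<alpha>2 / \<alpha> * \<zeta> \<omega>" for \<sigma>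
      by (intro tendsto_intros filterlim_compose[OF slope_tendsto[OF \<alpha>] a_lim])
    have "d \<longlonglongrightarrow> \<alpha>2 / \<alpha> * \<zeta> \<omega>"
    proof (rule order_tendstoI)
      fix u assume "\<alpha>2 / \<alpha> * \<zeta> \<omega> < u"
      from eventually_happens'[OF sequentially_bot order_tendstoD(2)[OF lim[of True] this]]
      obtain l where l: "slope (a True l) / a True l * \<zeta> \<omega> < u" by blast
      obtain R where R: "R \<longlonglongrightarrow> slope (a True l) / a True l * \<zeta> \<omega>" "\<forall>\<^sub>F n in sequentially. d n \<le> R n"
        using R[of True l] by auto
      from order_tendstoD(2)[OF R(1) l] R(2) show "\<forall>\<^sub>F n in sequentially. d n < u"
        by eventually_elim simp
    next
      fix u assume "u < \<alpha>2 / \<alpha> * \<zeta> \<omega>"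
      from eventually_happens'[OF sequentially_bot order_tendstoD(1)[OF lim[of False] this]]
      obtain l where l: "u < slope (a False l) / a False l * \<zeta> \<omega>" by blast
      obtain R where R: "R \<longlonglongrightarrow> slope (a False l) / a False l * \<zeta> \<omega>" "\<forall>\<^sub>F n in sequentially. R n \<le> d n"
        using R[of False l] by auto
      from order_tendstoD(1)[OF R(1) l] R(2) show "\<forall>\<^sub>F n in sequentially. u < d n"
        by eventually_elim simp
    qed
    then show ?case by (simp add: d_def[abs_def])
  qed
qed

section \<open>Late vertices\<close>

text \<open>
The rising factorial \<open>R\<close> of order \<open>k\<close> satisfies \<open>R (x + 1) = R x (1 + k / x)\<close>. If \<open>j\<close> is
chosen with probability at most \<open>\<alpha> (W + b) / (n + 1)\<close>, then the mean of \<open>R (W + b)\<close> grows by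
the factor \<open>1 + k \<alpha> / (n + 1)\<close> at most, whatever the value of \<open>W\<close>. The shift \<open>b\<close> absorbs
the uniform choices, as long as the number of vertices is at least \<open>c (n + 1)\<close>; this holds from some
time on, and factors at earlier times are replaced by 1.

For the vertex \<open>i + 1\<close>, which is absent up to time \<open>i\<close>, the product starts at time \<open>i\<close>. It stays
below \<open>(i + 1)\<^sup>2\<close> for all large \<open>i\<close>, since the inverse squares are summable, and
\<open>\<Prod> (1 + k \<alpha> / (m + 1)) \<le> (n / i)\<^bsup>k\<alpha>\<^esup>\<close> over \<open>i \<le> m < n\<close>. Hence
\<open>W\<^sup>k \<le> C i\<^bsup>2 - k\<alpha>\<^esup> n\<^bsup>k\<alpha>\<^esup>\<close>, and \<open>k \<alpha> \<ge> 3\<close> makes the factor tend to 0 as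
\<open>i\<close> grows.
\<close>

lemma AE_late_vertices_small:
  assumes \<alpha>: "0 < \<alpha>"
  shows "AE \<omega> in M. \<forall>\<epsilon>>0. \<exists>J. \<forall>j\<ge>J. \<forall>n. W (G n \<omega>) j \<le> \<epsilon> * real n powr \<alpha>"
proof -
  obtain c where c: "0 < c" and V_lower: "AE \<omega> in M. \<forall>\<^sub>F n in sequentially. c * (real n + 1) \<le> V (G n \<omega>)"
    by (rule AE_vertices_linear)
  obtain k :: nat where "3 < real k * \<alpha>"
    using reals_Archimedean3[OF \<alpha>] by blast
  then have k: "3 \<le> real k * \<alpha>" "k \<noteq> 0" by (auto intro: ccontr)
  \<comment> \<open>With this shift, \<open>V \<ge> c (n + 1)\<close> implies \<open>\<beta> / V \<le> \<alpha> b / (n + 1)\<close>.\<close>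
  define b where "b = \<beta> / (c * \<alpha>)"
  have b: "0 \<le> b" using rates c \<alpha> by (simp add: b_def)
  \<comment> \<open>The maximum makes the first appearance of a vertex, with weight 1, leave \<open>w\<close> unchanged.\<close>
  define w where "w s j = max (W s j) 1 + b" for s j
  define R where "R x = pochhammer x k" for x :: real
  define a where "a m = 1 + real k * \<alpha> / (real m + 1)" for m :: nat
  define y :: "nat \<Rightarrow> nat \<Rightarrow> graph_state \<Rightarrow> graph_state \<Rightarrow> real" where
    "y i m s s' = (if i \<le> m \<and> c * (real m + 1) \<le> V s
       then R (w s' (int i + 1)) / R (w s (int i + 1)) / a m else 1)" for i m s s'
  have w: "1 \<le> w s j" for s j using b by (simp add: w_def)
  have R_pos: "0 < R (w s j)" for s j
    unfolding R_def using w[of s j] by (intro pochhammer_pos) simp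
  have a_ge: "1 \<le> a m" for m using \<alpha> by (simp add: a_def)
  have y_nonneg: "0 \<le> y i m s s'" for i m s s'
    using R_pos a_ge[of m] by (auto simp: y_def intro!: divide_nonneg_nonneg less_imp_le)
  have ratio: "measure_pmf.expectation (step p q r s) (\<lambda>s'. R (w s' j) / R (w s j)) \<le> a n"
    if valid: "valid_state n s" and V_ge: "c * (real n + 1) \<le> V s" for n s j
  proof (cases "j \<in> vertices s")
    case True
    define h where "h = real k / w s j"
    have W1: "1 \<le> W s j" using vertex_weight_ge_1[OF valid True] by simp
    have h: "0 \<le> h" using w[of s j] by (simp add: h_def)
    have F: "R (w (interact t s) j) / R (w s j) = 1 + h * of_bool (j \<in> t)" for t
    proof (cases "j \<in> t")
      case True
      then have "w (interact t s) j = w s j + 1" using W1 by (simp add: w_def vertex_weight_interact)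
      then show ?thesis
        using pochhammer_shift_ratio[of "w s j" k] w[of s j] True by (simp add: R_def h_def)
    next
      case False
      then have "w (interact t s) j = w s j" by (simp add: w_def vertex_weight_interact)
      then show ?thesis using R_pos[of s j] False by simp
    qed
    have "measure_pmf.expectation (step p q r s) (\<lambda>s'. R (w s' j) / R (w s j)) \<le>
        1 + (\<alpha>2 * h + \<alpha>1 * h) * (W s j / (real n + 1)) + h * (\<beta> / V s)"
    proof (rule expectation_step_le[OF valid True])
      fix e assume "e \<in># edges s"
      have "j \<noteq> new_vertex s" using True new_vertex_fresh[OF valid] by auto
      then show "R (w (interact (insert (new_vertex s) e) s) j) / R (w s j) \<le> 1 + h * of_bool (j \<in> e)"
        by (simp add: F)
    qed (use p q r F in auto)
    also have "\<beta> / V s \<le> \<beta> / (c * (real n + 1))"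
      using rates c V_ge card_vertices(1)[OF valid] by (intro divide_left_mono) auto
    also have "\<beta> / (c * (real n + 1)) = \<alpha> * b / (real n + 1)"
      using \<alpha> c by (simp add: b_def)
    also have "1 + (\<alpha>2 * h + \<alpha>1 * h) * (W s j / (real n + 1)) + h * (\<alpha> * b / (real n + 1))
        = 1 + h * w s j * \<alpha> / (real n + 1)"
    proof -
      have "w s j = W s j + b" "\<alpha>2 * h + \<alpha>1 * h = \<alpha> * h"
        using W1 by (simp_all add: w_def rates(5) algebra_simps)
      then show ?thesis by (simp add: add_divide_distrib ring_distribs mult_ac)
    qed
    also have "\<dots> = a n" using w[of s j] by (simp add: h_def a_def)
    finally show ?thesis using h by (simp add: mult_left_mono)
  next
    case False
    have "measure_pmf.expectation (step p q r s) (\<lambda>s'. R (w s' j) / R (w s j))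
        \<le> measure_pmf.expectation (step p q r s) (\<lambda>_. 1)"
    proof (rule expectation_mono_finite[OF finite_step[OF valid]])
      fix s' assume "s' \<in> set_pmf (step p q r s)"
      then obtain t where "s' = interact t s" by (rule step_obtain)
      then have "w s' j = w s j"
        using vertex_weight_unborn[OF valid False] by (simp add: w_def vertex_weight_interact)
      then show "R (w s' j) / R (w s j) \<le> 1" using R_pos[of s j] by simp
    qed
    then show ?thesis using a_ge[of n] by simp
  qed
  have "(\<integral>\<^sup>+s'. ennreal (y i n s s') \<partial>step p q r s) \<le> 1" if "valid_state n s" for i n s
  proof (rule nn_integral_step_le_1[OF that y_nonneg])
    show "measure_pmf.expectation (step p q r s) (y i n s) \<le> 1"
    proof (cases "i \<le> n \<and> c * (real n + 1) \<le> V s")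
      case True
      then have "y i n s = (\<lambda>s'. R (w s' (int i + 1)) / R (w s (int i + 1)) / a n)"
        by (simp add: y_def fun_eq_iff)
      moreover have "measure_pmf.expectation (step p q r s)
          (\<lambda>s'. R (w s' (int i + 1)) / R (w s (int i + 1))) / a n \<le> 1"
        using ratio[OF that, of "int i + 1"] True a_ge[of n] by (simp only: divide_le_eq_1_pos simp_thms)
      ultimately show ?thesis by simp
    next
      case False
      then have "y i n s = (\<lambda>_. 1)" by (auto simp: y_def)
      then show ?thesis by simp
    qed
  qed
  moreover have "summable (\<lambda>i. 1 / (real i + 1) ^ 2)"
    using inverse_power_summable[of 2, where ?'a = real] summable_Suc_iff[of "\<lambda>n. inverse (real n ^ 2)"]
    by (simp add: inverse_eq_divide add.commute)
  ultimately have "AE \<omega> in M. \<forall>\<^sub>F i in sequentially. \<forall>n.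
      (\<Prod>m<n. y i m (G m \<omega>) (G (Suc m) \<omega>)) < (real i + 1) ^ 2"
    using y_nonneg
    by (intro AE_eventually_below[where I = valid_state] valid_initial valid_step) auto
  with AE_trajectory V_lower show ?thesis
  proof eventually_elim
    case (elim \<omega>)
    note valid = trajectory_valid[OF elim(1)]
    obtain N where N: "\<And>n. N \<le> n \<Longrightarrow> c * (real n + 1) \<le> V (G n \<omega>)"
      using elim(2) by (auto simp: eventually_sequentially)
    obtain I where I: "\<And>i n. I \<le> i \<Longrightarrow> (\<Prod>m<n. y i m (G m \<omega>) (G (Suc m) \<omega>)) < (real i + 1) ^ 2"
      using elim(3) unfolding eventually_sequentially by blast
    define R1 where "R1 = R (1 + b)"
    have R1: "0 < R1" unfolding R1_def R_def using b by (intro pochhammer_pos) simp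
    have weight_power: "W (G n \<omega>) (int i + 1) ^ k \<le> 4 * R1 / real i * (real n powr \<alpha>) ^ k"
      if i: "N \<le> i" "I \<le> i" "1 \<le> i" and n: "i \<le> n" for i n
    proof -
      define j where "j = int i + 1"
      have "j \<notin> vertices (G i \<omega>)" using vertex_label_bounds[OF valid[of i], of j] by (auto simp: j_def)
      then have w_i: "w (G i \<omega>) j = 1 + b" using vertex_weight_unborn[OF valid] by (simp add: w_def)
      have "(\<Prod>m<n. y i m (G m \<omega>) (G (Suc m) \<omega>)) = R (w (G n \<omega>) j) / R1 / (\<Prod>m=i..<n. a m)"
        using n
      proof (induction n rule: dec_induct)
        case base
        have "(\<Prod>m<i. y i m (G m \<omega>) (G (Suc m) \<omega>)) = 1" by (simp add: y_def)
        then show ?case using R1 by (simp add: w_i R1_def)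
      next
        case (step n)
        have "y i n (G n \<omega>) (G (Suc n) \<omega>) = R (w (G (Suc n) \<omega>) j) / R (w (G n \<omega>) j) / a n"
          using N[of n] step i by (simp add: y_def j_def)
        then show ?case
          using step R_pos[of "G n \<omega>" j] by simp
      qed
      moreover have prod_pos: "0 < (\<Prod>m=i..<n. a m)"
        using a_ge by (intro prod_pos ballI less_le_trans[OF zero_less_one])
      ultimately have 1: "R (w (G n \<omega>) j) \<le> (real i + 1) ^ 2 * R1 * (\<Prod>m=i..<n. a m)"
        using I[OF i(2), of n] R1 by (simp add: field_simps)
      have "(\<Prod>m=i..<n. a m) \<le> (\<Prod>m=i..<n. exp (real k * \<alpha> * (1 / real (Suc m))))"
      proof (rule prod_mono)
        fix m
        show "0 \<le> a m \<and> a m \<le> exp (real k * \<alpha> * (1 / real (Suc m)))"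
          using a_ge[of m] exp_ge_add_one_self[of "real k * \<alpha> * (1 / real (Suc m))"]
          by (simp add: a_def add.commute)
      qed
      also have "\<dots> = exp (real k * \<alpha> * (\<Sum>m=i..<n. 1 / real (Suc m)))"
        by (simp add: exp_sum sum_distrib_left)
      also have "\<dots> \<le> exp (real k * \<alpha> * ln (real n / real i))"
        using sum_inverse_Suc_le_ln[OF i(3) n] \<alpha> by (simp add: mult_left_mono)
      also have "\<dots> = (real n / real i) powr (real k * \<alpha>)"
        using i n by (simp add: powr_def)
      also have "\<dots> = (real n powr \<alpha>) ^ k / real i powr (real k * \<alpha>)"
      proof -
        have "(real n powr \<alpha>) ^ k = (real n powr \<alpha>) powr real k"
          using i n by (intro powr_realpow[symmetric]) simp
        then show ?thesis using i n by (simp add: powr_divide powr_powr mult.commute)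
      qed
      also have "\<dots> \<le> (real n powr \<alpha>) ^ k / real i ^ 3"
      proof -
        have "real i powr 3 \<le> real i powr (real k * \<alpha>)" using i k by (intro powr_mono) auto
        then show ?thesis using i by (intro divide_left_mono) auto
      qed
      finally have 2: "(\<Prod>m=i..<n. a m) \<le> (real n powr \<alpha>) ^ k / real i ^ 3" .
      have "W (G n \<omega>) j ^ k \<le> w (G n \<omega>) j ^ k" using b by (intro power_mono) (auto simp: w_def)
      also have "\<dots> \<le> R (w (G n \<omega>) j)"
        unfolding R_def using w[of "G n \<omega>" j] by (intro pochhammer_ge_power) simp
      also note 1
      also have "(real i + 1) ^ 2 * R1 * (\<Prod>m=i..<n. a m) \<le> (2 * real i) ^ 2 * R1 * ((real n powr \<alpha>) ^ k / real i ^ 3)"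
        using i R1 2 prod_pos by (intro mult_mono power_mono) auto
      also have "\<dots> = 4 * R1 / real i * (real n powr \<alpha>) ^ k"
        using i by (simp add: power2_eq_square power3_eq_cube)
      finally show ?thesis by (simp add: j_def)
    qed
    show ?case
    proof (intro allI impI)
      fix \<epsilon> :: real assume \<epsilon>: "0 < \<epsilon>"
      define i0 where "i0 = max (max N I) (max 1 (nat \<lceil>4 * R1 / \<epsilon> ^ k\<rceil>))"
      have "W (G n \<omega>) j \<le> \<epsilon> * real n powr \<alpha>" if j: "int i0 + 1 \<le> j" for j n
      proof (cases "j \<in> vertices (G n \<omega>)")
        case True
        define i where "i = nat (j - 1)"
        have i: "i0 \<le> i" "j = int i + 1" using j by (auto simp: i_def)
        have n: "i \<le> n" using vertex_label_bounds[OF valid True] i by simp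
        have "4 * R1 / \<epsilon> ^ k \<le> real i" "1 \<le> i" using i(1) unfolding i0_def by linarith+
        then have "4 * R1 / real i \<le> \<epsilon> ^ k" using \<epsilon> by (simp add: field_simps)
        then have "4 * R1 / real i * (real n powr \<alpha>) ^ k \<le> \<epsilon> ^ k * (real n powr \<alpha>) ^ k"
          by (rule mult_right_mono) simp
        moreover have "W (G n \<omega>) j ^ k \<le> 4 * R1 / real i * (real n powr \<alpha>) ^ k"
          using weight_power[of i n] i n by (simp add: i0_def)
        ultimately have "W (G n \<omega>) j ^ k \<le> (\<epsilon> * real n powr \<alpha>) ^ k"
          by (simp add: power_mult_distrib)
        then show ?thesis using k \<epsilon> by (subst (asm) power_mono_iff) auto
      next
        case False
        then show ?thesis using vertex_weight_unborn[OF valid False] \<epsilon> by simp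
      qed
      then show "\<exists>J. \<forall>j\<ge>J. \<forall>n. W (G n \<omega>) j \<le> \<epsilon> * real n powr \<alpha>" by blast
    qed
  qed
qed

section \<open>The maximal degree\<close>

text \<open>
Smallness with \<open>\<epsilon> = z (-2)\<close> shows that \<open>z\<close> attains its supremum at some vertex \<open>m\<close>. The degree
of \<open>m\<close> bounds the maximal degree from below. From above, a level \<open>u\<close> beyond the claimed limit is
eventually not reached by the finitely many early vertices, and late vertices stay below \<open>u / 2\<close>
because their degree is at most twice their weight.
\<close>

lemma max_degree_limit:
  assumes traj: "trajectory g" and \<kappa>: "0 \<le> \<kappa>"
    and z: "\<And>j. -2 \<le> j \<Longrightarrow> 0 < z j"
    and W_lim: "\<And>j. -2 \<le> j \<Longrightarrow> (\<lambda>n. W (g n) j / real n powr \<alpha>) \<longlonglongrightarrow> z j"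
    and D_lim: "\<And>j. -2 \<le> j \<Longrightarrow> (\<lambda>n. D (g n) j / real n powr \<alpha>) \<longlonglongrightarrow> \<kappa> * z j"
    and small: "\<And>\<epsilon>. 0 < \<epsilon> \<Longrightarrow> \<exists>J. \<forall>j\<ge>J. \<forall>n. W (g n) j \<le> \<epsilon> * real n powr \<alpha>"
  obtains \<mu> where "0 < \<mu>" "(SUP j\<in>{-2..}. ereal (z j)) = ereal \<mu>"
    "(\<lambda>n. real (max_degree (g n)) / real n powr \<alpha>) \<longlonglongrightarrow> \<kappa> * \<mu>"
proof -
  note valid = trajectory_valid[OF traj]
  obtain J where J: "\<And>j n. J \<le> j \<Longrightarrow> W (g n) j \<le> z (-2) * real n powr \<alpha>"
    using small[of "z (-2)"] z[of "-2"] by auto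
  have late: "z j \<le> z (-2)" if "J \<le> j" "-2 \<le> j" for j
  proof (rule tendsto_upperbound[OF W_lim[OF that(2)]])
    show "\<forall>\<^sub>F n in sequentially. W (g n) j / real n powr \<alpha> \<le> z (-2)"
      using eventually_gt_at_top[of 0] by eventually_elim (use J[OF that(1)] in \<open>simp add: divide_le_eq\<close>)
  qed simp
  define S where "S = {-2..max J (-2)}"
  have S: "finite S" "S \<noteq> {}" "-2 \<in> S" by (auto simp: S_def)
  then have "Max (z ` S) \<in> z ` S" by (intro Max_in) auto
  then obtain m where m: "m \<in> S" "z m = Max (z ` S)" by auto
  then have m2: "-2 \<le> m" by (simp add: S_def)
  have m_max: "z j \<le> z m" if "-2 \<le> j" for j
  proof (cases "j \<in> S")
    case True
    then show ?thesis using S m(2) by simp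
  next
    case False
    then have "z j \<le> z (-2)" using that by (intro late) (auto simp: S_def)
    also have "\<dots> \<le> z m" using S m(2) by simp
    finally show ?thesis .
  qed
  have "(SUP j\<in>{-2..}. ereal (z j)) = ereal (z m)"
    by (rule antisym) (auto intro!: SUP_least SUP_upper m_max m2)
  moreover have "(\<lambda>n. real (max_degree (g n)) / real n powr \<alpha>) \<longlonglongrightarrow> \<kappa> * z m"
  proof (rule order_tendstoI)
    fix u assume u: "u < \<kappa> * z m"
    have "vertex_degree (g n) m \<le> max_degree (g n)" for n
    proof (cases "m \<in> vertices (g n)")
      case True
      then show ?thesis
        unfolding max_degree_def using finite_vertices[OF valid] by (intro Max_ge) auto
    next
      case False
      then show ?thesis
        using vertex_degree_le_weight[OF valid, of n m] vertex_weight_unborn[OF valid False] by simp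
    qed
    then have le: "D (g n) m / real n powr \<alpha> \<le> real (max_degree (g n)) / real n powr \<alpha>" for n
      by (intro divide_right_mono) auto
    from order_tendstoD(1)[OF D_lim[OF m2] u]
    show "\<forall>\<^sub>F n in sequentially. u < real (max_degree (g n)) / real n powr \<alpha>"
      by eventually_elim (rule less_le_trans[OF _ le])
  next
    fix u assume u: "\<kappa> * z m < u"
    have "0 \<le> \<kappa> * z m" using \<kappa> z[OF m2] by simp
    then have u_pos: "0 < u" using u by simp
    obtain J where J: "\<And>j n. J \<le> j \<Longrightarrow> W (g n) j \<le> u / 4 * real n powr \<alpha>"
      using small[of "u / 4"] u_pos by auto
    have "\<forall>\<^sub>F n in sequentially. \<forall>j\<in>{-2..<J}. D (g n) j / real n powr \<alpha> < u"
    proof (rule eventually_ball_finite)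
      show "\<forall>j\<in>{-2..<J}. \<forall>\<^sub>F n in sequentially. D (g n) j / real n powr \<alpha> < u"
      proof
        fix j assume "j \<in> {-2..<J}"
        then have j: "-2 \<le> j" by simp
        have "\<kappa> * z j < u" using m_max[OF j] \<kappa> u by (meson le_less_trans mult_left_mono)
        then show "\<forall>\<^sub>F n in sequentially. D (g n) j / real n powr \<alpha> < u"
          by (rule order_tendstoD(2)[OF D_lim[OF j]])
      qed
    qed simp
    then show "\<forall>\<^sub>F n in sequentially. real (max_degree (g n)) / real n powr \<alpha> < u"
      using eventually_gt_at_top[of 0]
    proof eventually_elim
      case (elim n)
      have "vertices (g n) \<noteq> {}" using initial_vertices[OF valid, of 0 n] by auto
      then have "max_degree (g n) \<in> vertex_degree (g n) ` vertices (g n)"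
        unfolding max_degree_def using finite_vertices[OF valid] by (intro Max_in) auto
      then obtain v where v: "v \<in> vertices (g n)" "max_degree (g n) = vertex_degree (g n) v" by auto
      have pos: "0 < real n powr \<alpha>" using elim by simp
      show ?case
      proof (cases "v < J")
        case True
        then show ?thesis using elim(1) v vertex_label_bounds[OF valid v(1)] by auto
      next
        case False
        have "D (g n) v \<le> 2 * W (g n) v"
          using vertex_degree_le_weight[OF valid, of n v] by linarith
        also have "\<dots> \<le> 2 * (u / 4 * real n powr \<alpha>)" using J[of v n] False by simp
        also have "\<dots> < u * real n powr \<alpha>" using u_pos pos by simp
        finally show ?thesis using pos v(2) by (simp add: divide_less_eq)
      qed
    qed
  qed
  ultimately show thesis using that z[OF m2] by blast
qed

end

theorem theorem5p3:
  fixes p q r :: real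
    and M :: "'a measure"
    and G :: "nat \<Rightarrow> 'a \<Rightarrow> graph_state"
    and \<zeta> :: "int \<Rightarrow> 'a \<Rightarrow> real"
    and \<mu> :: "'a \<Rightarrow> ereal"
  assumes "0 < p" "p \<le> 1" and "0 \<le> q" "q \<le> 1" and "0 \<le> r" "r \<le> 1"
    and "three_interaction_process p q r M G"
    and "\<And>j. j \<ge> -2 \<Longrightarrow> \<zeta> j \<in> borel_measurable M"
    and "\<And>j. j \<ge> -2 \<Longrightarrow> AE \<omega> in M. 0 < \<zeta> j \<omega>"
    and "\<And>j. j \<ge> -2 \<Longrightarrow> AE \<omega> in M.
           (\<lambda>n. real (vertex_weight (G n \<omega>) j)) \<sim>[sequentially]
           (\<lambda>n. \<zeta> j \<omega> * real n powr alpha p q r)"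
  defines "\<mu> \<equiv> \<lambda>\<omega>. SUP j\<in>{-2..}. ereal (\<zeta> j \<omega>)"
  shows "\<mu> \<in> borel_measurable M \<and>
    (AE \<omega> in M. 0 < \<mu> \<omega> \<and> \<mu> \<omega> < \<infinity>) \<and>
    (AE \<omega> in M. (\<lambda>n. real (max_degree (G n \<omega>)) / real n powr alpha p q r)
        \<longlonglongrightarrow> alpha2 p r / alpha p q r * real_of_ereal (\<mu> \<omega>)) \<and>
    (alpha2 p r \<noteq> 0 \<longrightarrow> (AE \<omega> in M.
        (\<lambda>n. real (max_degree (G n \<omega>))) \<sim>[sequentially]
        (\<lambda>n. alpha2 p r / alpha p q r * real_of_ereal (\<mu> \<omega>) * real n powr alpha p q r)))"
proof -
  interpret prob_space M
    using assms(7) by (simp add: three_interaction_process_def)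
  interpret interaction_process p q r M G
    using assms(1-7) by unfold_locales (auto simp: three_interaction_process_def)
  have W_lim: "AE \<omega> in M. (\<lambda>n. W (G n \<omega>) j / real n powr \<alpha>) \<longlonglongrightarrow> \<zeta> j \<omega>" if j: "-2 \<le> j" for j
    using assms(9)[OF j] assms(10)[OF j]
  proof eventually_elim
    case (elim \<omega>)
    have "(\<lambda>n. \<zeta> j \<omega> * (if W (G n \<omega>) j = 0 \<and> \<zeta> j \<omega> * real n powr \<alpha> = 0 then 1
        else W (G n \<omega>) j / (\<zeta> j \<omega> * real n powr \<alpha>))) \<longlonglongrightarrow> \<zeta> j \<omega> * 1"
      using elim(2) unfolding asymp_equiv_def by (intro tendsto_mult tendsto_const)
    then have "(\<lambda>n. \<zeta> j \<omega> * (if W (G n \<omega>) j = 0 \<and> \<zeta> j \<omega> * real n powr \<alpha> = 0 then 1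
        else W (G n \<omega>) j / (\<zeta> j \<omega> * real n powr \<alpha>))) \<longlonglongrightarrow> \<zeta> j \<omega>" by simp
    then show ?case
    proof (rule Lim_transform_eventually)
      show "\<forall>\<^sub>F n in sequentially. \<zeta> j \<omega> * (if W (G n \<omega>) j = 0 \<and> \<zeta> j \<omega> * real n powr \<alpha> = 0 then 1
        else W (G n \<omega>) j / (\<zeta> j \<omega> * real n powr \<alpha>)) = W (G n \<omega>) j / real n powr \<alpha>"
        using eventually_gt_at_top[of 0] by eventually_elim (use elim(1) in auto)
    qed
  qed
  have main: "AE \<omega> in M. 0 < \<alpha> \<and> (\<exists>u>0. \<mu> \<omega> = ereal u \<and>
      (\<lambda>n. real (max_degree (G n \<omega>)) / real n powr \<alpha>) \<longlonglongrightarrow> \<alpha>2 / \<alpha> * u)"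
  proof (cases "\<alpha> = 0")
    case True
    have "AE \<omega> in M. (\<lambda>n. W (G n \<omega>) 0 / real n powr \<alpha>) \<longlonglongrightarrow> \<zeta> 0 \<omega>" by (rule W_lim) simp
    with AE_weight_unbounded_if_alpha_0[OF True] have "AE \<omega> in M. False"
    proof eventually_elim
      case (elim \<omega>)
      have "(\<lambda>n. W (G n \<omega>) 0) \<longlonglongrightarrow> \<zeta> 0 \<omega>"
        using elim(2)
      proof (rule Lim_transform_eventually)
        show "\<forall>\<^sub>F n in sequentially. W (G n \<omega>) 0 / real n powr \<alpha> = W (G n \<omega>) 0"
          using eventually_gt_at_top[of 0] by eventually_elim (simp add: True)
      qed
      then show False
        using elim(1) not_tendsto_and_filterlim_at_infinity[OF sequentially_bot]
          filterlim_at_top_imp_at_infinity by blast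
    qed
    then show ?thesis by (rule eventually_mono) simp
  next
    case False
    then have \<alpha>: "0 < \<alpha>" using rates by simp
    have all: "AE \<omega> in M. \<forall>j\<in>{-2..}. 0 < \<zeta> j \<omega>"
      "AE \<omega> in M. \<forall>j\<in>{-2..}. (\<lambda>n. W (G n \<omega>) j / real n powr \<alpha>) \<longlonglongrightarrow> \<zeta> j \<omega>"
      "AE \<omega> in M. \<forall>j\<in>{-2..}. (\<lambda>n. D (G n \<omega>) j / real n powr \<alpha>) \<longlonglongrightarrow> \<alpha>2 / \<alpha> * \<zeta> j \<omega>"
      using assms(9) W_lim AE_degree_growth[OF \<alpha> assms(9) W_lim]
      by (auto simp: AE_ball_countable)
    from AE_trajectory all AE_late_vertices_small[OF \<alpha>] show ?thesis
    proof eventually_elim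
      case (elim \<omega>)
      have "0 \<le> \<alpha>2 / \<alpha>" using rates by simp
      with elim obtain u where "0 < u" "(SUP j\<in>{-2..}. ereal (\<zeta> j \<omega>)) = ereal u"
        "(\<lambda>n. real (max_degree (G n \<omega>)) / real n powr \<alpha>) \<longlonglongrightarrow> \<alpha>2 / \<alpha> * u"
        by (elim max_degree_limit[of "\<lambda>n. G n \<omega>" "\<alpha>2 / \<alpha>" "\<lambda>j. \<zeta> j \<omega>"]) auto
      then show ?case using \<alpha> by (auto simp: \<mu>_def)
    qed
  qed
  have "\<mu> \<in> borel_measurable M"
    unfolding \<mu>_def using assms(8) by (intro borel_measurable_SUP) auto
  moreover have "AE \<omega> in M. 0 < \<mu> \<omega> \<and> \<mu> \<omega> < \<infinity>"
    using main by eventually_elim auto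
  moreover have "AE \<omega> in M. (\<lambda>n. real (max_degree (G n \<omega>)) / real n powr \<alpha>)
      \<longlonglongrightarrow> \<alpha>2 / \<alpha> * real_of_ereal (\<mu> \<omega>)"
    using main by eventually_elim auto
  moreover have "AE \<omega> in M. (\<lambda>n. real (max_degree (G n \<omega>))) \<sim>[sequentially]
      (\<lambda>n. \<alpha>2 / \<alpha> * real_of_ereal (\<mu> \<omega>) * real n powr \<alpha>)" if "\<alpha>2 \<noteq> 0"
    using main
  proof eventually_elim
    case (elim \<omega>)
    then obtain u where u: "0 < u" "\<mu> \<omega> = ereal u"
      "(\<lambda>n. real (max_degree (G n \<omega>)) / real n powr \<alpha>) \<longlonglongrightarrow> \<alpha>2 / \<alpha> * u" by blast
    have "\<alpha>2 / \<alpha> * u \<noteq> 0" using that u elim by simp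
    then have "(\<lambda>n. real (max_degree (G n \<omega>)) / real n powr \<alpha> / (\<alpha>2 / \<alpha> * u)) \<longlonglongrightarrow> 1"
      using tendsto_divide[OF u(3) tendsto_const[of "\<alpha>2 / \<alpha> * u"]] by simp
    then show ?case
      by (intro asymp_equivI') (simp add: u(2) field_simps)
  qed
  ultimately show ?thesis by blast
qed

end
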